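(* Let $d\ge 1$ and $n\ge 2$, and let $\mathcal C_1,\dots,\mathcal C_n$ be quantum channels, $\mathcal C_i$ going from a sender to receiver $B_i$. If there exists a one-way protocol for random-receiver communication of a $d$-dimensional quantum message through the channels $(\mathcal C_i)_{i=1}^n$, then for every $i\in\{1,\dots,n\}$ the channel $\mathcal C_i$ has quantum capacity at least $\log d$ qubits.
   Context: All quantum systems are finite-dimensional. $L(\mathcal H)$ denotes the linear operators on $\mathcal H$. A quantum channel is a completely positive trace-preserving linear map. $\log$ is base 2, and the quantum capacity is the usual (asymptotic, unassisted) quantum capacity measured in qubits per channel use. Random-receiver quantum communication: a sender is connected to $n$ spatially separated receivers $B_1,\dots,B_n$ by channels $\mathcal C_i:L(\mathcal H_i)\to L(\mathcal K_i)$. The sender must transmit a $d$-dimensional quantum message to receiver $B_x$, where $x\in\{1,\dots,n\}$ is unknown to the sender but known to all receivers. The receivers may exchange classical messages but not quantum systems. The protocol must work perfectly for all $x$. A one-way protocol (a single round of classical communication to the chosen receiver) consists of: - an encoding channel $\mathcal E: L(\mathbb C^d)\to L(\mathcal H_1\otimes\cdots\otimes\mathcal H_n)$, independent of $x$; - for every $x\in\{1,\dots,n\}$, a measurement (POVM) $(M^{(x)}_j)_j$ on $\bigotimes_{y\ne x}\mathcal K_y$, performed by the $n-1$ parties other than $B_x$ (using local operations and classical communication among them), whose outcome $j$ is communicated to $B_x$; - for every $x$ and every outcome $j$, a quantum channel $\mathcal B^{(x)}_j:L(\mathcal K_x)\to L(\mathbb C^d)$ performed by $B_x$. These are such that for every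 $x$ and every density operator $\rho$ on $\mathbb C^d$, $$\sum_j \mathcal B^{(x)}_j\Big(\operatorname{Tr}_{y\neq x}\big[(I_{\mathcal K_x}\otimes M^{(x)}_j)\,(\mathcal C_1\otimes\cdots\otimes\mathcal C_n)(\mathcal E(\rho))\big]\Big)=\rho ,$$ where $\operatorname{Tr}_{y\ne x}$ is the partial trace over $\bigotimes_{y\neq x}\mathcal K_y$ and tensor factors are ordered appropriately. *)

theory Defs
  imports Complex_Main "HOL-Library.FuncSet" "HOL-Library.Extended_Real"
begin

text \<open>
  The Hilbert space with orthonormal basis indexed by a finite set \<open>A\<close> is written \<open>A\<close>; an operator
  on it is its matrix, vanishing outside \<open>A \<times> A\<close>.  A system of dimension \<open>k\<close> has basis \<open>{..<k}\<close>.
  The tensor product of systems of dimensions \<open>k i\<close> for \<open>i \<in> I\<close> has as basis the choice functions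
  \<open>joint I k\<close>, so that no ordering or re-indexing of tensor factors is ever needed.
\<close>

type_synonym 'a op = "'a \<Rightarrow> 'a \<Rightarrow> complex"

abbreviation joint :: "'i set \<Rightarrow> ('i \<Rightarrow> nat) \<Rightarrow> ('i \<Rightarrow> nat) set" where
  "joint I k \<equiv> PiE I (\<lambda>i. {..<k i})"

definition ops :: "'a set \<Rightarrow> 'a op set" where
  "ops A = {X. \<forall>a b. X a b \<noteq> 0 \<longrightarrow> a \<in> A \<and> b \<in> A}"

definition id_op :: "'a set \<Rightarrow> 'a op" where
  "id_op A = (\<lambda>a b. if a = b \<and> a \<in> A then 1 else 0)"

definition unit_op :: "'a \<Rightarrow> 'a \<Rightarrow> 'a op" where
  "unit_op a b = (\<lambda>u v. if u = a \<and> v = b then 1 else 0)"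

definition op_mult :: "'a set \<Rightarrow> 'a op \<Rightarrow> 'a op \<Rightarrow> 'a op" where
  "op_mult A X Y = (\<lambda>a b. \<Sum>c\<in>A. X a c * Y c b)"

definition op_trace :: "'a set \<Rightarrow> 'a op \<Rightarrow> complex" where
  "op_trace A X = (\<Sum>a\<in>A. X a a)"

text \<open>The number \<open>\<langle>v|X|v\<rangle>\<close>.\<close>

definition expval :: "'a set \<Rightarrow> ('a \<Rightarrow> complex) \<Rightarrow> 'a op \<Rightarrow> complex" where
  "expval A v X = (\<Sum>a\<in>A. \<Sum>b\<in>A. cnj (v a) * X a b * v b)"

definition psd :: "'a set \<Rightarrow> 'a op \<Rightarrow> bool" where
  "psd A X \<longleftrightarrow> X \<in> ops A \<and> (\<forall>v. Im (expval A v X) = 0 \<and> 0 \<le> Re (expval A v X))"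

definition density :: "'a set \<Rightarrow> 'a op \<Rightarrow> bool" where
  "density A \<rho> \<longleftrightarrow> psd A \<rho> \<and> op_trace A \<rho> = 1"

definition linear_map :: "'a set \<Rightarrow> 'b set \<Rightarrow> ('a op \<Rightarrow> 'b op) \<Rightarrow> bool" where
  "linear_map A B \<Phi> \<longleftrightarrow>
     (\<forall>X\<in>ops A. \<Phi> X \<in> ops B) \<and>
     (\<forall>X\<in>ops A. \<forall>Y\<in>ops A. \<forall>c.
        \<Phi> (\<lambda>a b. c * X a b + Y a b) = (\<lambda>a b. c * \<Phi> X a b + \<Phi> Y a b))"

text \<open>The map \<open>id \<otimes> \<Phi>\<close>, which applies \<open>\<Phi>\<close> to every block of a block matrix.\<close>

definition amplify :: "('a op \<Rightarrow> 'b op) \<Rightarrow> ('r \<times> 'a) op \<Rightarrow> ('r \<times> 'b) op" where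
  "amplify \<Phi> X = (\<lambda>(s, a) (t, b). \<Phi> (\<lambda>a' b'. X (s, a') (t, b')) a b)"

definition cp_map :: "'a set \<Rightarrow> 'b set \<Rightarrow> ('a op \<Rightarrow> 'b op) \<Rightarrow> bool" where
  "cp_map A B \<Phi> \<longleftrightarrow> linear_map A B \<Phi> \<and>
     (\<forall>(r::nat) X. psd ({..<r} \<times> A) X \<longrightarrow> psd ({..<r} \<times> B) (amplify \<Phi> X))"

definition channel :: "'a set \<Rightarrow> 'b set \<Rightarrow> ('a op \<Rightarrow> 'b op) \<Rightarrow> bool" where
  "channel A B \<Phi> \<longleftrightarrow> cp_map A B \<Phi> \<and> (\<forall>X\<in>ops A. op_trace B (\<Phi> X) = op_trace A X)"

text \<open>
  The linear map \<open>\<Otimes>\<^sub>i C i\<close>, determined by its values \<open>\<Otimes>\<^sub>i C i (|s i\<rangle>\<langle>t i|)\<close> on the matrix units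
  \<open>|s\<rangle>\<langle>t|\<close>.
\<close>

definition tensor_map ::
  "'i set \<Rightarrow> ('i \<Rightarrow> nat) \<Rightarrow> ('i \<Rightarrow> nat) \<Rightarrow> ('i \<Rightarrow> nat op \<Rightarrow> nat op)
     \<Rightarrow> ('i \<Rightarrow> nat) op \<Rightarrow> ('i \<Rightarrow> nat) op" where
  "tensor_map I h k C X = (\<lambda>p q.
     if p \<in> joint I k \<and> q \<in> joint I k
     then \<Sum>s\<in>joint I h. \<Sum>t\<in>joint I h. X s t * (\<Prod>i\<in>I. C i (unit_op (s i) (t i)) (p i) (q i))
     else 0)"

text \<open>The operator \<open>\<one> \<otimes> M\<close>, with the identity on factor \<open>x\<close> and \<open>M\<close> acting on all the others.\<close>

definition id_tensor :: "'i set \<Rightarrow> ('i \<Rightarrow> nat) \<Rightarrow> 'i \<Rightarrow> ('i \<Rightarrow> nat) op \<Rightarrow> ('i \<Rightarrow> nat) op" where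
  "id_tensor I k x M = (\<lambda>p q.
     if p \<in> joint I k \<and> q \<in> joint I k \<and> p x = q x
     then M (restrict p (I - {x})) (restrict q (I - {x})) else 0)"

text \<open>The partial trace over all factors except \<open>x\<close>.\<close>

definition trace_others :: "'i set \<Rightarrow> ('i \<Rightarrow> nat) \<Rightarrow> 'i \<Rightarrow> ('i \<Rightarrow> nat) op \<Rightarrow> nat op" where
  "trace_others I k x Y = (\<lambda>a b. \<Sum>p\<in>joint (I - {x}) k. Y (p(x := a)) (p(x := b)))"

definition povm :: "'a set \<Rightarrow> 'j set \<Rightarrow> ('j \<Rightarrow> 'a op) \<Rightarrow> bool" where
  "povm A J M \<longleftrightarrow> finite J \<and> (\<forall>j\<in>J. psd A (M j)) \<and> (\<lambda>a b. \<Sum>j\<in>J. M j a b) = id_op A"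

text \<open>A quantum instrument with outcomes \<open>a < r\<close>; the output dimension \<open>l a\<close> may depend on \<open>a\<close>.\<close>

definition instrument :: "nat \<Rightarrow> nat \<Rightarrow> (nat \<Rightarrow> nat) \<Rightarrow> (nat \<Rightarrow> nat op \<Rightarrow> nat op) \<Rightarrow> bool" where
  "instrument k r l \<Phi> \<longleftrightarrow>
     (\<forall>a<r. cp_map {..<k} {..<l a} (\<Phi> a)) \<and>
     (\<forall>X\<in>ops {..<k}. (\<Sum>a<r. op_trace {..<l a} (\<Phi> a X)) = op_trace {..<k} X)"

text \<open>
  \<open>locc I k P\<close>: the parties \<open>I\<close>, holding systems of dimensions \<open>k\<close>, have a finite-round LOCC procedure
  which on the joint state \<open>X\<close> produces the classical outcome \<open>j\<close> with probability \<open>P j X\<close>.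
  Either they stop and declare an outcome, or some party \<open>y\<close> applies an instrument to its own system
  and broadcasts the result \<open>a\<close>, on which the whole continuation may depend.
\<close>

inductive locc ::
  "'i set \<Rightarrow> ('i \<Rightarrow> nat) \<Rightarrow> ('j \<Rightarrow> ('i \<Rightarrow> nat) op \<Rightarrow> complex) \<Rightarrow> bool" for I where
  stop: "locc I k (\<lambda>j X. if j = j\<^sub>0 then op_trace (joint I k) X else 0)"
| round: "\<lbrakk> y \<in> I; instrument (k y) r l \<Phi>; \<And>a. a < r \<Longrightarrow> locc I (k(y := l a)) (P a) \<rbrakk> \<Longrightarrow>
    locc I k (\<lambda>j X. \<Sum>a<r. P a j (tensor_map I k (k(y := l a)) ((\<lambda>_. id)(y := \<Phi> a)) X))"

definition locc_povm :: "'i set \<Rightarrow> ('i \<Rightarrow> nat) \<Rightarrow> 'j set \<Rightarrow> ('j \<Rightarrow> ('i \<Rightarrow> nat) op) \<Rightarrow> bool" where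
  "locc_povm I k J M \<longleftrightarrow> povm (joint I k) J M \<and>
     (\<exists>P. locc I k P \<and>
        (\<forall>j\<in>J. \<forall>X\<in>ops (joint I k). P j X = op_trace (joint I k) (op_mult (joint I k) (M j) X)))"

text \<open>
  One-way protocols for random-receiver communication of a \<open>d\<close>-dimensional message through the
  channels \<open>C i\<close> from dimension \<open>h i\<close> to dimension \<open>k i\<close>, for \<open>i \<in> {1..n}\<close>: encoder \<open>E\<close>, measurements
  \<open>M x\<close> with outcome sets \<open>J x\<close>, and decoders \<open>B x j\<close>.
\<close>

definition one_way_protocol ::
  "nat \<Rightarrow> nat \<Rightarrow> (nat \<Rightarrow> nat) \<Rightarrow> (nat \<Rightarrow> nat) \<Rightarrow> (nat \<Rightarrow> nat op \<Rightarrow> nat op)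
     \<Rightarrow> (nat op \<Rightarrow> (nat \<Rightarrow> nat) op) \<Rightarrow> (nat \<Rightarrow> nat set) \<Rightarrow> (nat \<Rightarrow> nat \<Rightarrow> (nat \<Rightarrow> nat) op)
     \<Rightarrow> (nat \<Rightarrow> nat \<Rightarrow> nat op \<Rightarrow> nat op) \<Rightarrow> bool" where
  "one_way_protocol d n h k C E J M B \<longleftrightarrow>
     channel {..<d} (joint {1..n} h) E \<and>
     (\<forall>x\<in>{1..n}.
        locc_povm ({1..n} - {x}) k (J x) (M x) \<and>
        (\<forall>j\<in>J x. channel {..<k x} {..<d} (B x j)) \<and>
        (\<forall>\<rho>. density {..<d} \<rho> \<longrightarrow>
           (\<lambda>a b. \<Sum>j\<in>J x.
              B x j (trace_others {1..n} k x
                (op_mult (joint {1..n} k) (id_tensor {1..n} k x (M x j))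
                   (tensor_map {1..n} h k C (E \<rho>)))) a b) = \<rho>))"

text \<open>
  Codes of dimension \<open>D\<close> for \<open>m\<close> uses of \<open>C\<close>.  The figure of merit is the worst-case entanglement
  fidelity: every pure state \<open>\<phi>\<close> of the message and a reference system of any dimension \<open>r\<close> must be
  preserved with fidelity at least \<open>1 - \<epsilon>\<close>.
\<close>

definition has_code :: "nat \<Rightarrow> nat \<Rightarrow> (nat op \<Rightarrow> nat op) \<Rightarrow> nat \<Rightarrow> nat \<Rightarrow> real \<Rightarrow> bool" where
  "has_code h k C m D \<epsilon> \<longleftrightarrow>
     (\<exists>Enc Dec.
        channel {..<D} (joint {..<m} (\<lambda>_. h)) Enc \<and>
        channel (joint {..<m} (\<lambda>_. k)) {..<D} Dec \<and>
        (\<forall>(r::nat) \<phi>. (\<Sum>z\<in>{..<r} \<times> {..<D}. (cmod (\<phi> z))\<^sup>2) = 1 \<longrightarrow>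
           1 - \<epsilon> \<le> Re (expval ({..<r} \<times> {..<D}) \<phi>
             (amplify (\<lambda>X. Dec (tensor_map {..<m} (\<lambda>_. h) (\<lambda>_. k) (\<lambda>_. C) (Enc X)))
                (\<lambda>z w. if z \<in> {..<r} \<times> {..<D} \<and> w \<in> {..<r} \<times> {..<D}
                       then \<phi> z * cnj (\<phi> w) else 0)))))"

definition achievable_rate :: "nat \<Rightarrow> nat \<Rightarrow> (nat op \<Rightarrow> nat op) \<Rightarrow> real \<Rightarrow> bool" where
  "achievable_rate h k C R \<longleftrightarrow>
     (\<forall>\<epsilon>>0. \<forall>\<delta>>0. \<forall>\<^sub>F m in sequentially.
        \<exists>D\<ge>1. R - \<delta> \<le> log 2 (real D) / real m \<and> has_code h k C m D \<epsilon>)"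

definition quantum_capacity :: "nat \<Rightarrow> nat \<Rightarrow> (nat op \<Rightarrow> nat op) \<Rightarrow> ereal" where
  "quantum_capacity h k C = (SUP R\<in>{R. 0 \<le> R \<and> achievable_rate h k C R}. ereal R)"

end

theory Submission
  imports Defs
begin

text \<open>
  Fix a receiver \<open>x\<close>.  The measurement outcomes \<open>j\<close> of the other parties split the protocol into a sum
  of completely positive maps \<open>B\<^sub>j \<circ> C\<^sub>x \<circ> F\<^sub>j\<close>, where \<open>F\<^sub>j\<close> absorbs the encoder, the other channels and the
  POVM element.  The sum is the identity, which is extremal, so each summand is \<open>p\<^sub>j\<close> times the identity,
  and some \<open>p\<^sub>j\<close> is positive.  Then \<open>F\<^sub>j / p\<^sub>j\<close> is trace preserving, so with the decoder \<open>B\<^sub>j\<close> it is a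
  perfect code of dimension \<open>d\<close> for a single use of \<open>C\<^sub>x\<close>; its tensor powers achieve the rate \<open>log d\<close>.
\<close>

subsection \<open>Positive semidefinite matrices and Kraus representations\<close>

text \<open>\<open>cp_map\<close> asks for positivity of every amplification, whereas the tensor
  product, the absorbed measurement and the extremality argument are all computed with Kraus
  operators. The bridge between the two forms is a Gram decomposition of positive semidefinite
  matrices, obtained by elimination, so that no spectral theorem enters. Absorbing the measurement
  into the encoder is legitimate because the other channels and the POVM element act on factors
  disjoint from \<open>x\<close>, hence commute with \<open>C x\<close>: the sender can simulate
  them in advance. A priori this conditioned encoder is only completely positive, since the
  probability of outcome j could depend on the message. Extremality excludes this: the decoder and
  \<open>C x\<close> preserve the trace, so the trace of F_j(X) equals that of p_j X for every X.
  All messages thus give outcome j with the same probability, and conditioning on j is division by a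
  constant, which stays linear. The resulting code is exact, so its tensor powers have error zero at
  every block length.\<close>

lemma opsI: "(\<And>a b. a \<notin> A \<or> b \<notin> A \<Longrightarrow> X a b = 0) \<Longrightarrow> X \<in> ops A"
  unfolding ops_def by blast

lemma opsD: "X \<in> ops A \<Longrightarrow> a \<notin> A \<or> b \<notin> A \<Longrightarrow> X a b = 0"
  unfolding ops_def by blast

lemma expval_mono_neutral:
  assumes "finite A" "S \<subseteq> A" "\<And>a. a \<in> A - S \<Longrightarrow> v a = 0"
  shows "expval A v X = expval S v X"
proof -
  have "expval A v X = (\<Sum>a\<in>S. \<Sum>b\<in>A. cnj (v a) * X a b * v b)"
    unfolding expval_def using assms by (intro sum.mono_neutral_right) auto
  also have "\<dots> = expval S v X"
    unfolding expval_def using assms by (intro sum.cong refl sum.mono_neutral_right) auto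
  finally show ?thesis .
qed

lemma expval_two:
  assumes "finite A" "a \<in> A" "b \<in> A" "a \<noteq> b"
  shows "expval A (\<lambda>u. if u = a then \<alpha> else if u = b then \<beta> else 0) X =
    cnj \<alpha> * X a a * \<alpha> + cnj \<alpha> * X a b * \<beta> + cnj \<beta> * X b a * \<alpha> + cnj \<beta> * X b b * \<beta>"
proof -
  have "expval A (\<lambda>u. if u = a then \<alpha> else if u = b then \<beta> else 0) X =
      expval {a, b} (\<lambda>u. if u = a then \<alpha> else if u = b then \<beta> else 0) X"
    by (rule expval_mono_neutral) (use assms in auto)
  then show ?thesis
    using assms(4) by (auto simp: expval_def)
qed

lemma expval_one:
  assumes "finite A" "a \<in> A"
  shows "expval A (\<lambda>u. if u = a then \<alpha> else 0) X = cnj \<alpha> * X a a * \<alpha>"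
proof -
  have "expval A (\<lambda>u. if u = a then \<alpha> else 0) X = expval {a} (\<lambda>u. if u = a then \<alpha> else 0) X"
    by (rule expval_mono_neutral) (use assms in auto)
  then show ?thesis
    by (simp add: expval_def)
qed

lemma psd_expval:
  assumes "psd A X"
  shows "Im (expval A v X) = 0" "0 \<le> Re (expval A v X)"
  using assms by (auto simp: psd_def)

lemma psd_ops: "psd A X \<Longrightarrow> X \<in> ops A"
  by (simp add: psd_def)

lemma psd_diagonal:
  assumes "finite A" "psd A X"
  shows "Im (X a a) = 0" "0 \<le> Re (X a a)"
proof -
  have "Im (X a a) = 0 \<and> 0 \<le> Re (X a a)"
  proof (cases "a \<in> A")
    case True
    then show ?thesis
      using psd_expval[OF assms(2), of "\<lambda>u. if u = a then 1 else 0"]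
      by (simp add: expval_one assms(1))
  next
    case False
    then have "X a a = 0"
      using psd_ops[OF assms(2)] by (auto simp: ops_def)
    then show ?thesis by simp
  qed
  then show "Im (X a a) = 0" "0 \<le> Re (X a a)" by auto
qed

text \<open>Polarization: \<open>psd\<close> only requires the quadratic form to be real. On e_a +
  e_b this makes the imaginary parts of the two entries opposite, on e_a + i e_b it makes their real
  parts equal.\<close>

lemma psd_hermitian:
  assumes "finite A" "psd A X"
  shows "X b a = cnj (X a b)"
proof (cases "a \<in> A \<and> b \<in> A \<and> a \<noteq> b")
  case True
  then have ex: "Im (cnj \<alpha> * X a a * \<alpha> + cnj \<alpha> * X a b * \<beta> + cnj \<beta> * X b a * \<alpha> + cnj \<beta> * X b b * \<beta>) = 0"
    for \<alpha> \<beta>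
    using psd_expval(1)[OF assms(2), of "\<lambda>u. if u = a then \<alpha> else if u = b then \<beta> else 0"] True
    by (simp add: expval_two[OF assms(1)])
  note d = psd_diagonal(1)[OF assms]
  have "Im (X a b) + Im (X b a) = 0" using ex[of 1 1] d by simp
  moreover have "Re (X a b) - Re (X b a) = 0" using ex[of 1 \<i>] d by simp
  ultimately show ?thesis by (simp add: complex_eq_iff)
next
  case False
  then show ?thesis
  proof (cases "a = b")
    case True
    then show ?thesis
      using psd_diagonal(1)[OF assms, of a] by (simp add: complex_eq_iff)
  next
    case ne: False
    then have "X a b = 0" "X b a = 0"
      using False psd_ops[OF assms(2)] by (auto simp: ops_def)
    then show ?thesis by simp
  qed
qed

text \<open>With \<open>X z z = 0\<close> the form at the vector -t (X z b) e_z + e_b has no term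
  quadratic in t: it is X b b - 2 t |X z b|^2. An affine function of t that is nonnegative for all
  real t has slope zero.\<close>

lemma psd_zero_diagonal:
  assumes "finite A" "psd A X" "X z z = 0"
  shows "X z b = 0"
proof (cases "z \<in> A \<and> b \<in> A \<and> z \<noteq> b")
  case True
  define q where "q = (cmod (X z b))\<^sup>2"
  have q: "cnj (X z b) * X z b = of_real q" 
    unfolding q_def by (metis complex_norm_square mult.commute)
  have "0 \<le> Re (X b b) - 2 * t * q" for t :: real
  proof -
    let ?\<alpha> = "- of_real t * X z b"
    have "0 \<le> Re (cnj ?\<alpha> * X z z * ?\<alpha> + cnj ?\<alpha> * X z b * 1 + cnj 1 * X b z * ?\<alpha> + cnj 1 * X b b * 1)"
      using psd_expval(2)[OF assms(2), of "\<lambda>u. if u = z then ?\<alpha> else if u = b then 1 else 0"]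
      unfolding expval_two[OF assms(1) conjunct1[OF True] conjunct1[OF conjunct2[OF True]] conjunct2[OF conjunct2[OF True]]] .
    also have "cnj ?\<alpha> * X z z * ?\<alpha> + cnj ?\<alpha> * X z b * 1 + cnj 1 * X b z * ?\<alpha> + cnj 1 * X b b * 1
        = X b b - 2 * of_real t * (cnj (X z b) * X z b)"
      using psd_hermitian[OF assms(1,2), of b z] assms(3) by (simp add: algebra_simps)
    finally show ?thesis unfolding q by simp
  qed
  \<comment> \<open>For nonzero \<open>q\<close> this value of \<open>t\<close> makes the expression
    equal to -1.\<close>
  from this[of "(Re (X b b) + 1) / (2 * q)"] have "q = 0"
    by (cases "q = 0") auto
  then show ?thesis by (simp add: q_def)
next
  case False
  then show ?thesis
    using psd_ops[OF assms(2)] assms(3) by (auto simp: ops_def)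
qed

lemma expval_insert:
  assumes "finite A" "z \<notin> A"
  shows "expval (insert z A) v X = expval A v X + cnj (v z) * (\<Sum>b\<in>A. X z b * v b)
    + (\<Sum>a\<in>A. cnj (v a) * X a z) * v z + cnj (v z) * X z z * v z"
  using assms
  by (simp add: expval_def sum.distrib sum_distrib_left sum_distrib_right algebra_simps)

lemma expval_cong:
  "(\<And>a. a \<in> A \<Longrightarrow> v a = w a) \<Longrightarrow> expval A v X = expval A w X"
  by (simp add: expval_def cong: sum.cong)

text \<open>A Cholesky factorization: each induction step removes one basis element z, splitting X
  into a rank-one term carrying row and column z and a Schur complement that lives on the remaining
  set.\<close>

lemma psd_decomposition:
  assumes "finite A" "psd A X"
  shows "\<exists>(N::nat) v. \<forall>a b. X a b = (\<Sum>i<N. v i a * cnj (v i b))"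
  using assms
proof (induction A arbitrary: X rule: finite_induct)
  case empty
  then have "X a b = 0" for a b by (auto simp: psd_def ops_def)
  then show ?case by (intro exI[of _ 0]) simp
next
  case (insert z A)
  have fin: "finite (insert z A)" using insert by simp
  note herm = psd_hermitian[OF fin insert.prems]
  define x where "x = Re (X z z)"
  have xz: "X z z = of_real x" "0 \<le> x"
    using psd_diagonal[OF fin insert.prems, of z] by (auto simp: x_def complex_eq_iff)
  \<comment> \<open>\<open>Y\<close> is the Schur complement of the pivot x and \<open>w\<close> the
    column of z divided by the square root of x. For x = 0 the column vanishes and division by zero
    gives 0, so the same formulas cover both cases.\<close>
  define Y where "Y = (\<lambda>a b. X a b - X a z * X z b / of_real x)"
  define w where "w = (\<lambda>a. X a z / of_real (sqrt x))"
  have col: "X z b = 0" "X b z = 0" if "x = 0" for b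
    using psd_zero_diagonal[OF fin insert.prems, of z b] herm[of b z] that xz by auto
  have Yz: "Y z b = 0" "Y b z = 0" for b
    using col xz by (auto simp: Y_def)
  have XY: "X a b = Y a b + w a * cnj (w b)" for a b
  proof -
    have "cnj (X b z) = X z b" using herm[of z b] by simp
    then have "w a * cnj (w b) = X a z * X z b / (of_real (sqrt x * sqrt x))"
      unfolding w_def of_real_mult by simp
    also have "sqrt x * sqrt x = x" using xz(2) by simp
    finally show ?thesis by (simp add: Y_def)
  qed
  have out: "X a b = 0" if "a \<notin> insert z A \<or> b \<notin> insert z A" for a b
    using psd_ops[OF insert.prems] that by (auto simp: ops_def)
  have "Y a b = 0" if "a \<notin> A \<or> b \<notin> A" for a b
  proof (cases "a = z \<or> b = z")
    case True
    then show ?thesis using Yz by blast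
  next
    case False
    then have "X a b = 0" "X a z * X z b = 0"
      using that out[of a b] out[of a z] out[of z b] by auto
    then show ?thesis by (simp add: Y_def)
  qed
  then have "Y \<in> ops A" unfolding ops_def by blast
  moreover have "Im (expval A v Y) = 0 \<and> 0 \<le> Re (expval A v Y)" for v
  proof -
    define s where "s = (\<Sum>b\<in>A. X z b * v b)"
    define s' where "s' = (\<Sum>a\<in>A. cnj (v a) * X a z)"
    \<comment> \<open>Completing the square: this choice of the coordinate at z minimizes the form
      of X for fixed other coordinates, and the minimum is the form of \<open>Y\<close>. Positivity
      of \<open>Y\<close> is therefore inherited from X.\<close>
    define u where "u = v(z := - s / of_real x)"
    have uA: "u a = v a" if "a \<in> A" for a using that insert.hyps by (auto simp: u_def)
    have s': "s' = cnj s"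
      by (auto simp: s_def s'_def herm[of z] intro!: sum.cong)
    have "expval (insert z A) u X = expval A u X + cnj (u z) * (\<Sum>b\<in>A. X z b * u b)
        + (\<Sum>a\<in>A. cnj (u a) * X a z) * u z + cnj (u z) * X z z * u z"
      by (rule expval_insert) (use insert.hyps in auto)
    also have "\<dots> = expval A v X + cnj (u z) * s + s' * u z + cnj (u z) * X z z * u z"
      using uA by (simp add: s_def s'_def expval_cong[of A u v] cong: sum.cong)
    also have "\<dots> = expval A v X - s' * s / of_real x"
      using s' xz by (simp add: u_def)
    also have "\<dots> = expval A v Y"
      unfolding expval_def Y_def s_def s'_def sum_product
      by (simp add: sum_subtractf sum_divide_distrib sum_distrib_left algebra_simps)
    finally show ?thesis using psd_expval[OF insert.prems] by metis
  qed
  ultimately have "psd A Y" by (simp add: psd_def)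
  then obtain N :: nat and v where v: "\<And>a b. Y a b = (\<Sum>i<N. v i a * cnj (v i b))"
    using insert.IH by blast
  have "X a b = (\<Sum>i<Suc N. (v(N := w)) i a * cnj ((v(N := w)) i b))" for a b
    using XY v by simp
  then show ?case by blast
qed

lemma expval_rank_one:
  "expval A v (\<lambda>a b. w a * cnj (w b)) = of_real ((cmod (\<Sum>a\<in>A. cnj (v a) * w a))\<^sup>2)"
proof -
  have "expval A v (\<lambda>a b. w a * cnj (w b))
      = (\<Sum>a\<in>A. cnj (v a) * w a) * (\<Sum>b\<in>A. cnj (w b) * v b)"
    by (simp add: expval_def sum_product mult.assoc)
  also have "(\<Sum>b\<in>A. cnj (w b) * v b) = cnj (\<Sum>a\<in>A. cnj (v a) * w a)"
    by (simp add: mult.commute)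
  finally have "expval A v (\<lambda>a b. w a * cnj (w b))
      = (\<Sum>a\<in>A. cnj (v a) * w a) * cnj (\<Sum>a\<in>A. cnj (v a) * w a)" .
  then show ?thesis by (metis complex_norm_square)
qed

lemma expval_sum:
  "expval A v (\<lambda>a b. \<Sum>i\<in>S. X i a b) = (\<Sum>i\<in>S. expval A v (X i))"
  unfolding expval_def sum_distrib_left sum_distrib_right
  by (simp only: sum.swap[of _ S A])

lemma psd_sum_rank_one:
  assumes "\<And>i a. i \<in> S \<Longrightarrow> w i a \<noteq> 0 \<Longrightarrow> a \<in> A"
  shows "psd A (\<lambda>a b. \<Sum>i\<in>S. w i a * cnj (w i b))"
proof -
  have "(\<Sum>i\<in>S. w i a * cnj (w i b)) = 0" if "a \<notin> A \<or> b \<notin> A" for a b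
    using assms that by (intro sum.neutral) fastforce
  then show ?thesis
    unfolding psd_def ops_def by (auto simp: expval_sum expval_rank_one sum_nonneg)
qed

lemma psd_rank_one:
  assumes "\<And>a. w a \<noteq> 0 \<Longrightarrow> a \<in> A"
  shows "psd A (\<lambda>a b. w a * cnj (w b))"
  using assms by (auto simp: psd_def ops_def expval_rank_one)

section \<open>Linear maps, Kraus maps and Choi's theorem\<close>

lemma linear_mapD:
  assumes "linear_map A B \<Phi>" "X \<in> ops A" "Y \<in> ops A"
  shows "\<Phi> (\<lambda>a b. c * X a b + Y a b) = (\<lambda>a b. c * \<Phi> X a b + \<Phi> Y a b)"
  using assms unfolding linear_map_def by blast

lemma linear_map_sum:
  assumes \<Phi>: "linear_map A B \<Phi>" and "finite S" and "\<And>i. i \<in> S \<Longrightarrow> Y i \<in> ops A"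
  shows "\<Phi> (\<lambda>a b. \<Sum>i\<in>S. c i * Y i a b) = (\<lambda>u v. \<Sum>i\<in>S. c i * \<Phi> (Y i) u v)"
  using assms(2,3)
proof (induction S rule: finite_induct)
  case empty
  have z: "(\<lambda>_ _. 0) \<in> ops A" by (simp add: ops_def)
  define Z :: "'a op" where "Z = (\<lambda>_ _. 0)"
  \<comment> \<open>The zero operator is sent to zero by cancellation: the instance of linearity
    with coefficient 1 says that the image of \<open>Z\<close> is twice itself.\<close>
  have "Z = (\<lambda>a b. 1 * Z a b + Z a b)" by (simp add: Z_def)
  then have "\<Phi> Z = \<Phi> (\<lambda>a b. 1 * Z a b + Z a b)" by (rule arg_cong)
  also have "\<dots> = (\<lambda>a b. 1 * \<Phi> Z a b + \<Phi> Z a b)"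
    using linear_mapD[OF \<Phi> z z, of 1] unfolding Z_def .
  finally have *: "\<Phi> Z = (\<lambda>a b. 1 * \<Phi> Z a b + \<Phi> Z a b)" .
  have "\<Phi> Z a b = 0" for a b
  proof -
    have "\<Phi> Z a b = 1 * \<Phi> Z a b + \<Phi> Z a b"
      by (rule fun_cong[OF fun_cong[OF *]])
    then show ?thesis by algebra
  qed
  then have "\<Phi> (\<lambda>_ _. 0) = (\<lambda>_ _. 0)" unfolding Z_def by (intro ext)
  then show ?case by simp
next
  case (insert i S)
  have "(\<Sum>i\<in>S. c i * Y i a b) = 0" if "a \<notin> A \<or> b \<notin> A" for a b
    using opsD[OF insert.prems that] by (intro sum.neutral) simp
  then have S: "(\<lambda>a b. \<Sum>i\<in>S. c i * Y i a b) \<in> ops A" unfolding ops_def by blast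
  have "\<Phi> (\<lambda>a b. \<Sum>i\<in>insert i S. c i * Y i a b)
      = \<Phi> (\<lambda>a b. c i * Y i a b + (\<Sum>i\<in>S. c i * Y i a b))"
    using insert.hyps by simp
  also have "\<dots> = (\<lambda>a b. c i * \<Phi> (Y i) a b + \<Phi> (\<lambda>a b. \<Sum>i\<in>S. c i * Y i a b) a b)"
    by (rule linear_mapD[OF \<Phi> insert.prems[OF insertI1] S])
  finally show ?case using insert by simp
qed

lemma unit_op_in_ops: "a \<in> A \<Longrightarrow> b \<in> A \<Longrightarrow> unit_op a b \<in> ops A"
  by (auto simp: unit_op_def ops_def)

lemma sum_unit_op:
  assumes "finite A" "X \<in> ops A"
  shows "(\<Sum>(a, b)\<in>A \<times> A. X a b * unit_op a b u v) = X u v"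
proof -
  have "(\<Sum>(a, b)\<in>A \<times> A. X a b * unit_op a b u v)
      = (\<Sum>z\<in>A \<times> A. if z = (u, v) then X u v else 0)"
    by (rule sum.cong) (auto simp: unit_op_def split: if_splits)
  also have "\<dots> = X u v"
    using assms by (auto simp: ops_def)
  finally show ?thesis .
qed

lemma linear_map_expand:
  assumes "linear_map A B \<Phi>" "finite A" "X \<in> ops A"
  shows "\<Phi> X u v = (\<Sum>a\<in>A. \<Sum>b\<in>A. X a b * \<Phi> (unit_op a b) u v)"
proof -
  have "X = (\<lambda>u v. \<Sum>z\<in>A \<times> A. X (fst z) (snd z) * unit_op (fst z) (snd z) u v)"
    using sum_unit_op[OF assms(2,3)] by (simp add: case_prod_beta)
  then have "\<Phi> X = \<Phi> (\<lambda>u v. \<Sum>z\<in>A \<times> A. X (fst z) (snd z) * unit_op (fst z) (snd z) u v)"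
    by metis
  also have "\<dots> = (\<lambda>u v. \<Sum>z\<in>A \<times> A. X (fst z) (snd z) * \<Phi> (unit_op (fst z) (snd z)) u v)"
    by (rule linear_map_sum[OF assms(1)]) (use assms(2) in \<open>auto intro!: unit_op_in_ops\<close>)
  finally show ?thesis
    by (simp add: sum.cartesian_product case_prod_beta)
qed

text \<open>The index set \<open>S\<close> has an arbitrary type because later families are indexed
  by choice functions (tensor products) and by pairs (measurements pulled back through a
  map).\<close>

definition kraus_map :: "'a set \<Rightarrow> 'i set \<Rightarrow> ('i \<Rightarrow> 'b \<Rightarrow> 'a \<Rightarrow> complex) \<Rightarrow> 'a op \<Rightarrow> 'b op" where
  "kraus_map A S K X = (\<lambda>u v. \<Sum>i\<in>S. \<Sum>a\<in>A. \<Sum>b\<in>A. K i u a * X a b * cnj (K i v b))"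

text \<open>Write the amplified input as a sum of rank-one matrices of vectors x_l. Its image is the
  sum of the rank-one matrices of (id tensor K_i) x_l over all pairs (i, l), which is positive
  semidefinite by its form.\<close>

lemma kraus_map_cp:
  assumes "finite A" "finite B"
    and K: "\<And>i u a. i \<in> S \<Longrightarrow> a \<in> A \<Longrightarrow> K i u a \<noteq> 0 \<Longrightarrow> u \<in> B"
    and \<Phi>: "\<And>X. X \<in> ops A \<Longrightarrow> \<Phi> X = kraus_map A S K X"
  shows "cp_map A B \<Phi>"
proof -
  have supp: "kraus_map A S K X u v = 0" if "u \<notin> B \<or> v \<notin> B" for X u v
    unfolding kraus_map_def using K that by (intro sum.neutral ballI) auto
  have ops: "\<Phi> X \<in> ops B" if "X \<in> ops A" for X
    using supp[of _ _ X] \<Phi>[OF that] unfolding ops_def by auto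
  have "linear_map A B \<Phi>"
    unfolding linear_map_def
  proof (intro conjI ballI allI)
    fix X Y c assume XY: "X \<in> ops A" "Y \<in> ops A"
    then have "(\<lambda>a b. c * X a b + Y a b) \<in> ops A"
      using opsD[OF XY(1)] opsD[OF XY(2)] by (intro opsI) simp
    then show "\<Phi> (\<lambda>a b. c * X a b + Y a b) = (\<lambda>a b. c * \<Phi> X a b + \<Phi> Y a b)"
      using XY by (simp add: \<Phi> kraus_map_def sum_distrib_left algebra_simps sum.distrib)
  qed (rule ops)
  moreover have "psd ({..<r} \<times> B) (amplify \<Phi> X)" if X: "psd ({..<r} \<times> A) X" for r :: nat and X
  proof -
    have Xo: "X \<in> ops ({..<r} \<times> A)" using X by (rule psd_ops)
    have blk: "(\<lambda>a b. X (s, a) (t, b)) \<in> ops A" for s t using Xo by (auto simp: ops_def)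
    have fin: "finite ({..<r} \<times> A)" using assms(1) by simp
    obtain N :: nat and x where x: "\<And>z w. X z w = (\<Sum>l<N. x l z * cnj (x l w))"
      using psd_decomposition[OF fin X] by metis
    define w where "w = (\<lambda>(i, l) (s, u). if s < r \<and> u \<in> B then \<Sum>a\<in>A. K i u a * x l (s, a) else 0)"
    have "amplify \<Phi> X (s, u) (t, v) = (\<Sum>j\<in>S \<times> {..<N}. w j (s, u) * cnj (w j (t, v)))" for s u t v
    proof (cases "s < r \<and> t < r \<and> u \<in> B \<and> v \<in> B")
      case True
      have "amplify \<Phi> X (s, u) (t, v) = kraus_map A S K (\<lambda>a b. X (s, a) (t, b)) u v"
        using \<Phi>[OF blk] by (simp add: amplify_def)
      also have "\<dots> = (\<Sum>i\<in>S. \<Sum>a\<in>A. \<Sum>b\<in>A. \<Sum>l<N. K i u a * (x l (s, a) * cnj (x l (t, b))) * cnj (K i v b))"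
        unfolding kraus_map_def by (simp only: x sum_distrib_left sum_distrib_right)
      also have "\<dots> = (\<Sum>i\<in>S. \<Sum>l<N. \<Sum>a\<in>A. \<Sum>b\<in>A. K i u a * (x l (s, a) * cnj (x l (t, b))) * cnj (K i v b))"
        by (simp only: sum.swap[of _ "{..<N}" A])
      also have "\<dots> = (\<Sum>j\<in>S \<times> {..<N}. w j (s, u) * cnj (w j (t, v)))"
        using True by (simp add: w_def sum.cartesian_product' sum_product mult_ac)
      finally show ?thesis .
    next
      case False
      have "amplify \<Phi> X (s, u) (t, v) = 0"
      proof (cases "s < r \<and> t < r")
        case True
        then show ?thesis using False ops[OF blk] by (auto simp: amplify_def ops_def)
      next
        case F: False
        then have "(\<lambda>a b. X (s, a) (t, b)) = (\<lambda>_ _. 0)"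
          using Xo by (intro ext) (auto simp: ops_def)
        then have "\<Phi> (\<lambda>a b. X (s, a) (t, b)) = kraus_map A S K (\<lambda>_ _. 0)"
          using \<Phi>[OF blk] by metis
        then show ?thesis by (simp add: amplify_def kraus_map_def)
      qed
      moreover have "w j (s, u) * cnj (w j (t, v)) = 0" for j
        using False by (auto simp: w_def split: prod.splits)
      ultimately show ?thesis by (simp only: sum.neutral_const)
    qed
    then have "amplify \<Phi> X = (\<lambda>z y. \<Sum>j\<in>S \<times> {..<N}. w j z * cnj (w j y))"
      by (intro ext) (metis surj_pair)
    moreover have "psd ({..<r} \<times> B) (\<lambda>z y. \<Sum>j\<in>S \<times> {..<N}. w j z * cnj (w j y))"
      by (rule psd_sum_rank_one) (auto simp: w_def split: if_splits)
    ultimately show ?thesis by simp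
  qed
  ultimately show ?thesis by (simp add: cp_map_def)
qed

lemma cp_map_linear: "cp_map A B \<Phi> \<Longrightarrow> linear_map A B \<Phi>"
  by (simp add: cp_map_def)

lemma cp_map_ops: "cp_map A B \<Phi> \<Longrightarrow> X \<in> ops A \<Longrightarrow> \<Phi> X \<in> ops B"
  by (simp add: cp_map_def linear_map_def)

text \<open>Choi's theorem. Amplify by a reference copy of \<open>A\<close> and apply the map to the
  unnormalized maximally entangled vector \<open>w\<close>. The blocks of the output are the images
  of the matrix units, and the Gram vectors of the output, reshaped into matrices, are the Kraus
  operators.\<close>

lemma cp_map_kraus:
  assumes cp: "cp_map A B \<Phi>" and "finite A" "finite B"
  obtains N :: nat and K
    where "\<And>i u a. i < N \<Longrightarrow> a \<in> A \<Longrightarrow> K i u a \<noteq> 0 \<Longrightarrow> u \<in> B"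
      and "\<And>X. X \<in> ops A \<Longrightarrow> \<Phi> X = kraus_map A {..<N} K X"
proof -
  \<comment> \<open>The references in \<open>cp_map\<close> are initial segments of the naturals, so
    the copy of \<open>A\<close> has to be numbered.\<close>
  obtain e where e: "bij_betw e A {..<card A}"
    using ex_bij_betw_finite_nat[OF assms(2)] by (auto simp: atLeast0LessThan)
  have inj: "e a = e b \<longleftrightarrow> a = b" if "a \<in> A" "b \<in> A" for a b
    using e that by (meson bij_betw_def inj_on_eq_iff)
  have lt: "e a < card A" if "a \<in> A" for a
    using bij_betw_apply[OF e that] by simp
  define w :: "nat \<times> 'a \<Rightarrow> complex" where "w = (\<lambda>(s, a). if a \<in> A \<and> e a = s then 1 else 0)"
  define X where "X = (\<lambda>z y. w z * cnj (w y))"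
  have "psd ({..<card A} \<times> A) X"
    unfolding X_def by (rule psd_rank_one) (auto simp: w_def lt split: if_splits)
  then have psd: "psd ({..<card A} \<times> B) (amplify \<Phi> X)"
    using cp by (auto simp: cp_map_def)
  have fin: "finite ({..<card A} \<times> B)"
    using assms by simp
  have unit: "(\<lambda>a' b'. X (e a, a') (e b, b')) = unit_op a b" if "a \<in> A" "b \<in> A" for a b
    using that inj by (intro ext) (auto simp: X_def w_def unit_op_def)
  obtain N :: nat and v where v: "\<And>z y. amplify \<Phi> X z y = (\<Sum>i<N. v i z * cnj (v i y))"
    using psd_decomposition[OF fin psd] by metis
  \<comment> \<open>The cut to \<open>B\<close> builds in the support condition, which
    \<open>psd_decomposition\<close> does not state for its vectors.\<close>
  define K where "K = (\<lambda>i u a. if u \<in> B then v i (e a, u) else 0)"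
  have unitK: "\<Phi> (unit_op a b) u u' = (\<Sum>i<N. K i u a * cnj (K i u' b))" if "a \<in> A" "b \<in> A" for a b u u'
  proof (cases "u \<in> B \<and> u' \<in> B")
    case True
    have "\<Phi> (unit_op a b) u u' = amplify \<Phi> X (e a, u) (e b, u')"
      using unit[OF that] by (simp add: amplify_def)
    then show ?thesis using True by (simp add: v K_def)
  next
    case False
    then show ?thesis
      using opsD[OF cp_map_ops[OF cp unit_op_in_ops[OF that]], of u u'] by (auto simp: K_def)
  qed
  have "\<Phi> Y = kraus_map A {..<N} K Y" if "Y \<in> ops A" for Y
  proof (intro ext)
    fix u u'
    have "\<Phi> Y u u' = (\<Sum>a\<in>A. \<Sum>b\<in>A. Y a b * \<Phi> (unit_op a b) u u')"
      by (rule linear_map_expand[OF cp_map_linear[OF cp] assms(2) that])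
    also have "\<dots> = (\<Sum>a\<in>A. \<Sum>b\<in>A. \<Sum>i<N. K i u a * Y a b * cnj (K i u' b))"
      using unitK by (simp add: sum_distrib_left mult_ac cong: sum.cong)
    also have "\<dots> = kraus_map A {..<N} K Y u u'"
      unfolding kraus_map_def by (simp only: sum.swap[of _ "{..<N}" A])
    finally show "\<Phi> Y u u' = kraus_map A {..<N} K Y u u'" .
  qed
  moreover have "i < N \<Longrightarrow> a \<in> A \<Longrightarrow> K i u a \<noteq> 0 \<Longrightarrow> u \<in> B" for i u a
    by (auto simp: K_def split: if_splits)
  ultimately show ?thesis using that by blast
qed

lemma kraus_map_unit_op:
  assumes "finite A" "a \<in> A" "b \<in> A"
  shows "kraus_map A S K (unit_op a b) u v = (\<Sum>i\<in>S. K i u a * cnj (K i v b))"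
proof -
  have "(\<Sum>a'\<in>A. \<Sum>b'\<in>A. K i u a' * unit_op a b a' b' * cnj (K i v b')) = K i u a * cnj (K i v b)" for i
  proof -
    have "(\<Sum>a'\<in>A. \<Sum>b'\<in>A. K i u a' * unit_op a b a' b' * cnj (K i v b'))
        = (\<Sum>a'\<in>A. if a' = a then \<Sum>b'\<in>A. if b' = b then K i u a * cnj (K i v b) else 0 else 0)"
      unfolding unit_op_def by (intro sum.cong refl) (auto intro!: sum.cong)
    then show ?thesis using assms by simp
  qed
  then show ?thesis by (simp add: kraus_map_def)
qed

lemma cp_map_comp:
  assumes "cp_map A B \<Phi>" "cp_map B C \<Psi>"
  shows "cp_map A C (\<lambda>X. \<Psi> (\<Phi> X))"
proof -
  have "linear_map A C (\<lambda>X. \<Psi> (\<Phi> X))"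
    using cp_map_ops[OF assms(1)] cp_map_ops[OF assms(2)]
      linear_mapD[OF cp_map_linear[OF assms(1)]] linear_mapD[OF cp_map_linear[OF assms(2)]]
    by (simp add: linear_map_def)
  moreover have "amplify (\<lambda>X. \<Psi> (\<Phi> X)) X = amplify \<Psi> (amplify \<Phi> X)" for X :: "(nat \<times> 'a) op"
    by (intro ext) (auto simp: amplify_def)
  ultimately show ?thesis
    using assms by (simp add: cp_map_def)
qed

lemma channel_comp:
  assumes "channel A B \<Phi>" "channel B C \<Psi>"
  shows "channel A C (\<lambda>X. \<Psi> (\<Phi> X))"
  using assms cp_map_comp[of A B \<Phi> C \<Psi>] cp_map_ops[of A B \<Phi>] by (simp add: channel_def)

subsection \<open>Tensor products of channels\<close>

lemma finite_joint: "finite I \<Longrightarrow> finite (joint I k)"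
  by (simp add: finite_PiE)

lemma tensor_map_unit_op:
  assumes "finite I" "s \<in> joint I h" "t \<in> joint I h" "p \<in> joint I k" "q \<in> joint I k"
  shows "tensor_map I h k C (unit_op s t) p q = (\<Prod>i\<in>I. C i (unit_op (s i) (t i)) (p i) (q i))"
proof -
  have "tensor_map I h k C (unit_op s t) p q = (\<Sum>s'\<in>joint I h. if s' = s then
      \<Sum>t'\<in>joint I h. if t' = t then (\<Prod>i\<in>I. C i (unit_op (s i) (t i)) (p i) (q i)) else 0 else 0)"
    using assms unfolding tensor_map_def
    by (auto simp: unit_op_def intro!: sum.cong)
  then show ?thesis
    using assms finite_joint[OF assms(1), of h] by simp
qed

text \<open>A Kraus operator of the tensor product is a product of one Kraus operator per factor,
  selected by a choice function f. Distributing the product over the factorwise Kraus sums gives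
  exactly the sum over these f.\<close>

lemma tensor_map_cp:
  assumes "finite I" and cp: "\<And>i. i \<in> I \<Longrightarrow> cp_map {..<h i} {..<k i} (C i)"
  shows "cp_map (joint I h) (joint I k) (tensor_map I h k C)"
proof -
  have "\<exists>(N::nat) K. (\<forall>X\<in>ops {..<h i}. C i X = kraus_map {..<h i} {..<N} K X)" if "i \<in> I" for i
    using cp_map_kraus[OF cp[OF that]] by (metis finite_lessThan)
  then obtain N :: "'a \<Rightarrow> nat" and K where
    K: "\<And>i X. i \<in> I \<Longrightarrow> X \<in> ops {..<h i} \<Longrightarrow> C i X = kraus_map {..<h i} {..<N i} (K i) X"
    by metis
  define L where "L = (\<lambda>f p s. if p \<in> joint I k then \<Prod>i\<in>I. K i (f i) (p i) (s i) else 0)"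
  have prod: "(\<Prod>i\<in>I. C i (unit_op (s i) (t i)) (p i) (q i))
      = (\<Sum>f\<in>joint I N. L f p s * cnj (L f q t))"
    if "s \<in> joint I h" "t \<in> joint I h" "p \<in> joint I k" "q \<in> joint I k" for s t p q
  proof -
    have "(\<Prod>i\<in>I. C i (unit_op (s i) (t i)) (p i) (q i))
        = (\<Prod>i\<in>I. \<Sum>j<N i. K i j (p i) (s i) * cnj (K i j (q i) (t i)))"
    proof (rule prod.cong[OF refl])
      fix i assume i: "i \<in> I"
      then have "s i < h i" "t i < h i" using that by (auto dest: PiE_mem)
      then show "C i (unit_op (s i) (t i)) (p i) (q i)
          = (\<Sum>j<N i. K i j (p i) (s i) * cnj (K i j (q i) (t i)))"
        using i by (simp add: K unit_op_in_ops kraus_map_unit_op)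
    qed
    also have "\<dots> = (\<Sum>f\<in>joint I N. \<Prod>i\<in>I. K i (f i) (p i) (s i) * cnj (K i (f i) (q i) (t i)))"
      by (rule prod_sum_PiE) (use assms in auto)
    also have "\<dots> = (\<Sum>f\<in>joint I N. L f p s * cnj (L f q t))"
      using that by (simp add: L_def prod.distrib)
    finally show ?thesis .
  qed
  show ?thesis
  proof (rule kraus_map_cp[where S = "joint I N" and K = L])
    fix X assume "X \<in> ops (joint I h)"
    show "tensor_map I h k C X = kraus_map (joint I h) (joint I N) L X"
    proof (intro ext)
      fix p q
      show "tensor_map I h k C X p q = kraus_map (joint I h) (joint I N) L X p q"
      proof (cases "p \<in> joint I k \<and> q \<in> joint I k")
        case True
        then have "tensor_map I h k C X p q
            = (\<Sum>s\<in>joint I h. \<Sum>t\<in>joint I h. \<Sum>f\<in>joint I N. L f p s * X s t * cnj (L f q t))"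
          unfolding tensor_map_def by (simp add: prod sum_distrib_left mult_ac)
        also have "\<dots> = (\<Sum>s\<in>joint I h. \<Sum>f\<in>joint I N. \<Sum>t\<in>joint I h. L f p s * X s t * cnj (L f q t))"
          by (intro sum.cong refl sum.swap)
        also have "\<dots> = (\<Sum>f\<in>joint I N. \<Sum>s\<in>joint I h. \<Sum>t\<in>joint I h. L f p s * X s t * cnj (L f q t))"
          by (rule sum.swap)
        finally show ?thesis by (simp add: kraus_map_def)
      next
        case False
        then have "p \<notin> joint I k \<or> q \<notin> joint I k" by blast
        then show ?thesis
          by (elim disjE) (simp_all add: tensor_map_def kraus_map_def L_def)
      qed
    qed
  qed (use assms(1) in \<open>auto simp: L_def finite_joint split: if_splits\<close>)
qed

lemma op_trace_unit_op: "finite A \<Longrightarrow> a \<in> A \<Longrightarrow> op_trace A (unit_op a b) = (if a = b then 1 else 0)"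
  by (auto simp: op_trace_def unit_op_def intro!: sum.neutral)

text \<open>On a matrix unit the trace factorizes into the traces of the factors, each 1 or 0
  according to whether the two indices agree there. By extensionality of choice functions the
  product is 1 exactly on the diagonal units.\<close>

lemma tensor_map_channel:
  assumes "finite I" and ch: "\<And>i. i \<in> I \<Longrightarrow> channel {..<h i} {..<k i} (C i)"
  shows "channel (joint I h) (joint I k) (tensor_map I h k C)"
proof -
  have "op_trace (joint I k) (tensor_map I h k C X) = op_trace (joint I h) X" for X
  proof -
    have tr: "(\<Sum>p\<in>joint I k. \<Prod>i\<in>I. C i (unit_op (s i) (t i)) (p i) (p i)) = (if s = t then 1 else 0)"
      if st: "s \<in> joint I h" "t \<in> joint I h" for s t
    proof -
      have "(\<Sum>p\<in>joint I k. \<Prod>i\<in>I. C i (unit_op (s i) (t i)) (p i) (p i))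
          = (\<Prod>i\<in>I. op_trace {..<k i} (C i (unit_op (s i) (t i))))"
        unfolding op_trace_def by (rule prod_sum_PiE[symmetric]) (use assms in auto)
      also have "\<dots> = (\<Prod>i\<in>I. if s i = t i then 1 else 0)"
      proof (rule prod.cong[OF refl])
        fix i assume i: "i \<in> I"
        then have "s i \<in> {..<h i}" "t i \<in> {..<h i}" using st by (auto dest: PiE_mem)
        then show "op_trace {..<k i} (C i (unit_op (s i) (t i))) = (if s i = t i then 1 else 0)"
          using ch[OF i] unit_op_in_ops op_trace_unit_op[OF finite_lessThan]
          by (metis channel_def)
      qed
      also have "\<dots> = (if \<forall>i\<in>I. s i = t i then 1 else 0)"
        using assms(1) by (auto intro: prod_zero)
      also have "(\<forall>i\<in>I. s i = t i) \<longleftrightarrow> s = t"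
        using PiE_ext[OF st] by blast
      finally show ?thesis .
    qed
    have "op_trace (joint I k) (tensor_map I h k C X) = (\<Sum>p\<in>joint I k. \<Sum>s\<in>joint I h. \<Sum>t\<in>joint I h.
        X s t * (\<Prod>i\<in>I. C i (unit_op (s i) (t i)) (p i) (p i)))"
      by (simp add: op_trace_def tensor_map_def)
    also have "\<dots> = (\<Sum>s\<in>joint I h. \<Sum>p\<in>joint I k. \<Sum>t\<in>joint I h.
        X s t * (\<Prod>i\<in>I. C i (unit_op (s i) (t i)) (p i) (p i)))"
      by (rule sum.swap)
    also have "\<dots> = (\<Sum>s\<in>joint I h. \<Sum>t\<in>joint I h. \<Sum>p\<in>joint I k.
        X s t * (\<Prod>i\<in>I. C i (unit_op (s i) (t i)) (p i) (p i)))"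
      by (intro sum.cong refl sum.swap)
    also have "\<dots> = (\<Sum>s\<in>joint I h. \<Sum>t\<in>joint I h. if s = t then X s t else 0)"
      by (intro sum.cong refl) (simp add: tr sum_distrib_left[symmetric])
    also have "\<dots> = op_trace (joint I h) X"
      using finite_joint[OF assms(1), of h] by (simp add: op_trace_def)
    finally show ?thesis .
  qed
  then show ?thesis
    using tensor_map_cp[OF assms(1)] ch by (simp add: channel_def)
qed

text \<open>In every factor the intermediate operator is expanded in matrix units. Distributing the
  product over this double sum, once for rows and once for columns, turns it into a sum over joint
  intermediate indices.\<close>

lemma tensor_map_comp:
  assumes "finite I"
    and "\<And>i. i \<in> I \<Longrightarrow> linear_map {..<h i} {..<k i} (C i)"
    and "\<And>i. i \<in> I \<Longrightarrow> linear_map {..<k i} {..<l i} (D i)"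
  shows "tensor_map I k l D (tensor_map I h k C X) = tensor_map I h l (\<lambda>i Y. D i (C i Y)) X"
proof (intro ext)
  fix p q
  show "tensor_map I k l D (tensor_map I h k C X) p q = tensor_map I h l (\<lambda>i Y. D i (C i Y)) X p q"
  proof (cases "p \<in> joint I l \<and> q \<in> joint I l")
    case True
    let ?J = "joint I h" and ?K = "joint I k"
    let ?c = "\<lambda>s t u v. \<Prod>i\<in>I. C i (unit_op (s i) (t i)) (u i) (v i)"
    let ?d = "\<lambda>u v. \<Prod>i\<in>I. D i (unit_op (u i) (v i)) (p i) (q i)"
    have dc: "(\<Prod>i\<in>I. D i (C i (unit_op (s i) (t i))) (p i) (q i)) = (\<Sum>u\<in>?K. \<Sum>v\<in>?K. ?c s t u v * ?d u v)"
      if "s \<in> ?J" "t \<in> ?J" for s t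
    proof -
      have "(\<Prod>i\<in>I. D i (C i (unit_op (s i) (t i))) (p i) (q i)) =
          (\<Prod>i\<in>I. \<Sum>a<k i. \<Sum>b<k i. C i (unit_op (s i) (t i)) a b * D i (unit_op a b) (p i) (q i))"
      proof (rule prod.cong[OF refl])
        fix i assume i: "i \<in> I"
        then have "unit_op (s i) (t i) \<in> ops {..<h i}"
          using that by (intro unit_op_in_ops) (auto dest: PiE_mem)
        then have "C i (unit_op (s i) (t i)) \<in> ops {..<k i}"
          using assms(2)[OF i] by (simp add: linear_map_def)
        then show "D i (C i (unit_op (s i) (t i))) (p i) (q i) =
            (\<Sum>a<k i. \<Sum>b<k i. C i (unit_op (s i) (t i)) a b * D i (unit_op a b) (p i) (q i))"
          by (rule linear_map_expand[OF assms(3)[OF i] finite_lessThan])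
      qed
      also have "\<dots> = (\<Sum>u\<in>?K. \<Prod>i\<in>I. \<Sum>b<k i. C i (unit_op (s i) (t i)) (u i) b * D i (unit_op (u i) b) (p i) (q i))"
        by (rule prod_sum_PiE) (use assms in auto)
      also have "\<dots> = (\<Sum>u\<in>?K. \<Sum>v\<in>?K. \<Prod>i\<in>I. C i (unit_op (s i) (t i)) (u i) (v i) * D i (unit_op (u i) (v i)) (p i) (q i))"
        by (intro sum.cong refl prod_sum_PiE) (use assms in auto)
      finally show ?thesis by (simp add: prod.distrib)
    qed
    have "tensor_map I k l D (tensor_map I h k C X) p q
        = (\<Sum>u\<in>?K. \<Sum>v\<in>?K. (\<Sum>s\<in>?J. \<Sum>t\<in>?J. X s t * ?c s t u v) * ?d u v)"
      using True by (simp add: tensor_map_def)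
    also have "\<dots> = (\<Sum>u\<in>?K. \<Sum>v\<in>?K. \<Sum>z\<in>?J \<times> ?J. X (fst z) (snd z) * (?c (fst z) (snd z) u v * ?d u v))"
      by (simp add: sum.cartesian_product' sum_distrib_right mult.assoc)
    also have "\<dots> = (\<Sum>u\<in>?K. \<Sum>z\<in>?J \<times> ?J. \<Sum>v\<in>?K. X (fst z) (snd z) * (?c (fst z) (snd z) u v * ?d u v))"
      by (intro sum.cong refl sum.swap)
    also have "\<dots> = (\<Sum>z\<in>?J \<times> ?J. \<Sum>u\<in>?K. \<Sum>v\<in>?K. X (fst z) (snd z) * (?c (fst z) (snd z) u v * ?d u v))"
      by (rule sum.swap)
    also have "\<dots> = (\<Sum>s\<in>?J. \<Sum>t\<in>?J. X s t * (\<Sum>u\<in>?K. \<Sum>v\<in>?K. ?c s t u v * ?d u v))"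
      by (simp add: sum.cartesian_product' sum_distrib_left)
    also have "\<dots> = tensor_map I h l (\<lambda>i Y. D i (C i Y)) X p q"
      using True unfolding tensor_map_def by (simp add: dc)
    finally show ?thesis .
  next
    case False
    then show ?thesis by (auto simp: tensor_map_def)
  qed
qed

lemma tensor_map_id:
  assumes "finite I" "X \<in> ops (joint I h)"
    and "\<And>i Y. i \<in> I \<Longrightarrow> Y \<in> ops {..<h i} \<Longrightarrow> D i Y = Y"
  shows "tensor_map I h h D X = X"
proof (intro ext)
  fix p q
  show "tensor_map I h h D X p q = X p q"
  proof (cases "p \<in> joint I h \<and> q \<in> joint I h")
    case True
    have "(\<Prod>i\<in>I. D i (unit_op (s i) (t i)) (p i) (q i)) = (if s = p \<and> t = q then 1 else 0)"
      if "s \<in> joint I h" "t \<in> joint I h" for s t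
    proof -
      have "(\<Prod>i\<in>I. D i (unit_op (s i) (t i)) (p i) (q i)) = (\<Prod>i\<in>I. if s i = p i \<and> t i = q i then 1 else 0)"
      proof (rule prod.cong[OF refl])
        fix i assume i: "i \<in> I"
        then have "unit_op (s i) (t i) \<in> ops {..<h i}"
          using that by (intro unit_op_in_ops) (auto dest: PiE_mem)
        then show "D i (unit_op (s i) (t i)) (p i) (q i) = (if s i = p i \<and> t i = q i then 1 else 0)"
          using assms(3)[OF i] by (auto simp: unit_op_def)
      qed
      also have "\<dots> = (if \<forall>i\<in>I. s i = p i \<and> t i = q i then 1 else 0)"
        using assms(1) by (auto intro: prod_zero)
      also have "(\<forall>i\<in>I. s i = p i \<and> t i = q i) \<longleftrightarrow> s = p \<and> t = q"
        using that True by (metis PiE_ext)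
      finally show ?thesis .
    qed
    then have "tensor_map I h h D X p q = (\<Sum>s\<in>joint I h. \<Sum>t\<in>joint I h. X s t * (if s = p \<and> t = q then 1 else 0))"
      using True unfolding tensor_map_def by simp
    also have "\<dots> = (\<Sum>s\<in>joint I h. if s = p then \<Sum>t\<in>joint I h. if t = q then X p q else 0 else 0)"
      by (intro sum.cong refl) (auto intro!: sum.cong)
    also have "\<dots> = X p q"
      using True finite_joint[OF assms(1), of h] by simp
    finally show ?thesis .
  next
    case False
    then show ?thesis using opsD[OF assms(2), of p q] by (auto simp: tensor_map_def)
  qed
qed

subsection \<open>Extremality of the identity channel\<close>

lemma cp_map_psd:
  assumes "cp_map A B \<Phi>" "psd A X"
  shows "psd B (\<Phi> X)"
proof -
  \<comment> \<open>\<open>cp_map\<close> speaks of amplified maps only, so \<open>X\<close> is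
    placed into an amplification by a one-dimensional reference.\<close>
  define Y :: "(nat \<times> 'a) op" where "Y = (\<lambda>(s, a) (t, b). if s = 0 \<and> t = 0 then X a b else 0)"
  have one: "expval ({..<Suc 0} \<times> S) v Z = expval S (\<lambda>a. v (0, a)) (\<lambda>a b. Z (0, a) (0, b))"
    for S :: "'c set" and v Z
    by (simp add: expval_def sum.cartesian_product')
  have "Y \<in> ops ({..<Suc 0} \<times> A)"
    using psd_ops[OF assms(2)] by (auto simp: ops_def Y_def split: if_splits)
  then have "psd ({..<Suc 0} \<times> A) Y"
    using psd_expval[OF assms(2)] by (simp add: psd_def one) (simp add: Y_def)
  then have amp: "psd ({..<Suc 0} \<times> B) (amplify \<Phi> Y)"
    using assms(1) by (auto simp: cp_map_def)
  have "expval B v (\<Phi> X) = expval ({..<Suc 0} \<times> B) (\<lambda>z. v (snd z)) (amplify \<Phi> Y)" for v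
    by (simp add: one amplify_def) (simp add: Y_def)
  then show ?thesis
    using psd_expval[OF amp] cp_map_ops[OF assms(1) psd_ops[OF assms(2)]] by (simp add: psd_def)
qed

lemma kraus_map_rank_one:
  "kraus_map A S K (\<lambda>a b. w a * cnj (w b)) =
    (\<lambda>u v. \<Sum>i\<in>S. (\<Sum>a\<in>A. K i u a * w a) * cnj (\<Sum>a\<in>A. K i v a * w a))"
  by (simp add: kraus_map_def sum_product mult_ac)

lemma sum_two_points:
  fixes \<alpha> \<beta> :: "'z :: comm_monoid_add"
  assumes "finite A" "a \<in> A" "b \<in> A"
  shows "(\<Sum>x\<in>A. (if x = a then \<alpha> else 0) + (if x = b then \<beta> else 0)) = \<alpha> + \<beta>"
  using assms by (simp add: sum.distrib)

lemma density_rank_one: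
  assumes "\<And>a. w a \<noteq> 0 \<Longrightarrow> a \<in> A" "(\<Sum>a\<in>A. (cmod (w a))\<^sup>2) = 1"
  shows "density A (\<lambda>a b. w a * cnj (w b))"
proof -
  have "op_trace A (\<lambda>a b. w a * cnj (w b)) = of_real (\<Sum>a\<in>A. (cmod (w a))\<^sup>2)"
    unfolding op_trace_def of_real_sum by (simp only: complex_norm_square)
  then show ?thesis
    using assms psd_rank_one[of w A] by (simp add: density_def)
qed

text \<open>
  The identity channel is extremal: a Kraus operator \<open>L\<close> of one of the summands maps every vector
  \<open>v\<close> into the span of \<open>v\<close>, so \<open>L\<close> is a multiple of the identity.
\<close>

lemma cp_summand_of_id:
  fixes T :: "'j \<Rightarrow> 'a op \<Rightarrow> 'a op"
  assumes A: "finite A" and "finite J" and cp: "\<And>j. j \<in> J \<Longrightarrow> cp_map A A (T j)"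
    and id: "\<And>\<rho>. density A \<rho> \<Longrightarrow> (\<lambda>a b. \<Sum>j\<in>J. T j \<rho> a b) = \<rho>"
    and j: "j \<in> J"
  obtains p :: real where "0 \<le> p" "\<And>X. X \<in> ops A \<Longrightarrow> T j X = (\<lambda>a b. of_real p * X a b)"
proof -
  obtain N :: nat and K where K: "\<And>X. X \<in> ops A \<Longrightarrow> T j X = kraus_map A {..<N} K X"
    using cp_map_kraus[OF cp[OF j] A A] by metis
  \<comment> \<open>For orthogonal u and v, the values of the form at u on the images of |v><v|
    under the summands are nonnegative and add up to |<u,v>|^2 = 0, so each is 0. For summand j the
    value is the sum over i of |<u, K_i v>|^2, hence every K_i v is orthogonal to u.\<close>
  have orth: "(\<Sum>a\<in>A. cnj (u a) * (\<Sum>b\<in>A. K i a b * v b)) = 0"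
    if v: "\<And>a. v a \<noteq> 0 \<Longrightarrow> a \<in> A" "(\<Sum>a\<in>A. (cmod (v a))\<^sup>2) = 1"
      and uv: "(\<Sum>a\<in>A. cnj (u a) * v a) = 0" and i: "i < N" for u v i
  proof -
    define \<rho> where "\<rho> = (\<lambda>a b. v a * cnj (v b))"
    have dens: "density A \<rho>"
      unfolding \<rho>_def by (rule density_rank_one) (use v in auto)
    then have psd: "psd A \<rho>" by (simp add: density_def)
    have nonneg: "0 \<le> Re (expval A u (T j' \<rho>))" if "j' \<in> J" for j'
      using psd_expval(2)[OF cp_map_psd[OF cp[OF that] psd]] .
    have "Re (expval A u (T j \<rho>)) \<le> (\<Sum>j'\<in>J. Re (expval A u (T j' \<rho>)))"
      using nonneg j \<open>finite J\<close> by (intro member_le_sum) auto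
    also have "\<dots> = Re (expval A u (\<lambda>a b. \<Sum>j\<in>J. T j \<rho> a b))"
      by (simp add: expval_sum)
    also have "\<dots> = 0"
      unfolding id[OF dens] by (simp add: \<rho>_def expval_rank_one uv)
    finally have "Re (expval A u (T j \<rho>)) \<le> 0" .
    moreover have "Re (expval A u (T j \<rho>))
        = (\<Sum>i<N. (cmod (\<Sum>a\<in>A. cnj (u a) * (\<Sum>b\<in>A. K i a b * v b)))\<^sup>2)"
      unfolding K[OF psd_ops[OF psd]] unfolding \<rho>_def kraus_map_rank_one expval_sum expval_rank_one
      by simp
    moreover have "(cmod (\<Sum>a\<in>A. cnj (u a) * (\<Sum>b\<in>A. K i a b * v b)))\<^sup>2
        \<le> (\<Sum>i<N. (cmod (\<Sum>a\<in>A. cnj (u a) * (\<Sum>b\<in>A. K i a b * v b)))\<^sup>2)"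
      using i by (intro member_le_sum) auto
    ultimately have "(cmod (\<Sum>a\<in>A. cnj (u a) * (\<Sum>b\<in>A. K i a b * v b)))\<^sup>2 \<le> 0"
      by linarith
    then show ?thesis by simp
  qed
  have off: "K i a b = 0" if "i < N" "a \<in> A" "b \<in> A" "a \<noteq> b" for i a b
  proof -
    define u v :: "'a \<Rightarrow> complex"
      where "u = (\<lambda>x. if x = a then 1 else 0)" and "v = (\<lambda>x. if x = b then 1 else 0)"
    have delta: "(\<Sum>x\<in>A. f x * (if x = c then 1 else 0)) = f c" if "c \<in> A"
      for f :: "'a \<Rightarrow> complex" and c
    proof -
      have "(\<Sum>x\<in>A. f x * (if x = c then 1 else 0)) = (\<Sum>x\<in>A. if x = c then f c else 0)"
        by (intro sum.cong) auto
      then show ?thesis using A that by simp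
    qed
    have "(\<Sum>x\<in>A. cnj (u x) * (\<Sum>y\<in>A. K i x y * v y)) = 0"
    proof (rule orth)
      have "(\<Sum>x\<in>A. (cmod (v x))\<^sup>2) = (\<Sum>x\<in>A. if x = b then 1 else 0)"
        by (intro sum.cong) (auto simp: v_def)
      then show "(\<Sum>x\<in>A. (cmod (v x))\<^sup>2) = 1"
        using A that by simp
      show "(\<Sum>x\<in>A. cnj (u x) * v x) = 0"
        using that by (intro sum.neutral) (auto simp: u_def v_def)
    qed (use that in \<open>auto simp: v_def split: if_splits\<close>)
    moreover have "(\<Sum>y\<in>A. K i x y * v y) = K i x b" for x
      unfolding v_def by (rule delta[OF that(3)])
    moreover have "cnj (u x) * z = z * (if x = a then 1 else 0)" for x z
      by (simp add: u_def)
    ultimately show ?thesis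
      using delta[OF that(2), of "\<lambda>x. K i x b"] by simp
  qed
  have diag: "K i a a = K i b b" if i: "i < N" and a: "a \<in> A" and b: "b \<in> A" for i a b
  proof (cases "a = b")
    case False
    \<comment> \<open>The factor normalizes v, the sum of the two basis vectors, because the
      hypothesis on the sum of the summands concerns density operators. Testing against the
      orthogonal difference u compares the two diagonal entries.\<close>
    define c where "c = complex_of_real (1 / sqrt 2)"
    have c: "(cmod c)\<^sup>2 = 1 / 2" by (simp add: c_def norm_divide power_divide)
    have c0: "c \<noteq> 0" by (simp add: c_def)
    define v where "v = (\<lambda>x. if x = a \<or> x = b then c else 0)"
    define u :: "'a \<Rightarrow> complex" where "u = (\<lambda>x. if x = a then 1 else if x = b then - 1 else 0)"
    note pm = sum_two_points[OF A a b]
    have "(\<Sum>x\<in>A. cnj (u x) * (\<Sum>y\<in>A. K i x y * v y)) = 0"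
    proof (rule orth)
      have "(\<Sum>x\<in>A. (cmod (v x))\<^sup>2) = (\<Sum>x\<in>A. (if x = a then 1 / 2 else 0) + (if x = b then 1 / 2 else 0))"
        using c False by (intro sum.cong) (auto simp: v_def)
      then show "(\<Sum>x\<in>A. (cmod (v x))\<^sup>2) = 1"
        by (simp add: pm)
      have "(\<Sum>x\<in>A. cnj (u x) * v x) = (\<Sum>x\<in>A. (if x = a then c else 0) + (if x = b then - c else 0))"
        using False by (intro sum.cong) (auto simp: v_def u_def)
      then show "(\<Sum>x\<in>A. cnj (u x) * v x) = 0"
        by (simp add: pm)
    qed (use a b i in \<open>auto simp: v_def split: if_splits\<close>)
    moreover have "(\<Sum>y\<in>A. K i x y * v y) = K i x x * v x" if "x \<in> A" for x
    proof -
      have "(\<Sum>y\<in>A. K i x y * v y) = (\<Sum>y\<in>A. if y = x then K i x x * v x else 0)"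
        using off[OF i that] by (intro sum.cong) auto
      then show ?thesis using A that by simp
    qed
    ultimately have "0 = (\<Sum>x\<in>A. cnj (u x) * (K i x x * v x))" by simp
    also have "\<dots> = (\<Sum>x\<in>A. (if x = a then K i a a * c else 0) + (if x = b then - K i b b * c else 0))"
      using False by (intro sum.cong) (auto simp: v_def u_def)
    also have "\<dots> = (K i a a - K i b b) * c"
      by (simp add: pm algebra_simps)
    finally show ?thesis using c0 by simp
  qed simp
  \<comment> \<open>All diagonal entries agree, so any element of \<open>A\<close> may name the
    scalar. For empty \<open>A\<close> the value is arbitrary, and no entry refers to it.\<close>
  define c where "c = (\<lambda>i. K i (SOME a. a \<in> A) (SOME a. a \<in> A))"
  have Kc: "K i a b = (if a = b then c i else 0)" if "i < N" "a \<in> A" "b \<in> A" for i a b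
  proof (cases "a = b")
    case True
    then show ?thesis
      using diag[OF that(1,2), of "SOME a. a \<in> A"] someI[of "\<lambda>a. a \<in> A", OF that(2)] by (simp add: c_def)
  qed (use off that in auto)
  define p where "p = (\<Sum>i<N. (cmod (c i))\<^sup>2)"
  have "T j X = (\<lambda>a b. of_real p * X a b)" if X: "X \<in> ops A" for X
  proof (intro ext)
    fix u v
    show "T j X u v = of_real p * X u v"
    proof (cases "u \<in> A \<and> v \<in> A")
      case True
      have "(\<Sum>a\<in>A. \<Sum>b\<in>A. K i u a * X a b * cnj (K i v b)) = X u v * of_real ((cmod (c i))\<^sup>2)"
        if "i < N" for i
      proof -
        have "(\<Sum>a\<in>A. \<Sum>b\<in>A. K i u a * X a b * cnj (K i v b)) =
            (\<Sum>a\<in>A. if a = u then \<Sum>b\<in>A. if b = v then c i * X u v * cnj (c i) else 0 else 0)"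
          using True by (intro sum.cong refl) (auto simp: Kc[OF that] intro!: sum.cong sum.neutral)
        also have "\<dots> = X u v * (c i * cnj (c i))"
          using True A by simp
        finally show ?thesis by (simp only: complex_norm_square)
      qed
      then show ?thesis
        unfolding K[OF X] kraus_map_def p_def by (simp add: sum_distrib_left mult.commute)
    next
      case False
      then show ?thesis
        using opsD[OF X, of u v] opsD[OF cp_map_ops[OF cp[OF j] X], of u v] by auto
    qed
  qed
  moreover have "0 \<le> p" by (simp add: p_def sum_nonneg)
  ultimately show ?thesis using that by blast
qed

subsection \<open>Measuring the other receivers\<close>

lemma sum_joint_split:
  fixes f :: "('i \<Rightarrow> nat) \<Rightarrow> 'z :: comm_monoid_add"
  assumes "x \<in> I"
  shows "(\<Sum>q\<in>joint I k. f q) = (\<Sum>c<k x. \<Sum>q\<in>joint (I - {x}) k. f (q(x := c)))"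
proof -
  have I: "insert x (I - {x}) = I" using assms by auto
  have "(\<Sum>q\<in>joint I k. f q)
      = (\<Sum>q\<in>(\<lambda>(y, g). g(x := y)) ` ({..<k x} \<times> joint (I - {x}) k). f q)"
    using PiE_insert_eq[of x "I - {x}" "\<lambda>i. {..<k i}"] I by simp
  also have "\<dots> = (\<Sum>(c, q)\<in>{..<k x} \<times> joint (I - {x}) k. f (q(x := c)))"
    using inj_combinator[of x "I - {x}" "\<lambda>i. {..<k i}"]
    by (subst sum.reindex) (simp_all add: case_prod_beta')
  finally show ?thesis by (simp add: sum.cartesian_product)
qed

lemma upd_in_joint_iff:
  assumes "x \<in> I" "q \<in> joint (I - {x}) k"
  shows "q(x := c) \<in> joint I k \<longleftrightarrow> c < k x"
proof
  assume "q(x := c) \<in> joint I k"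
  then show "c < k x" using assms(1) by (auto dest: PiE_mem)
next
  assume "c < k x"
  then show "q(x := c) \<in> joint I k"
    using PiE_fun_upd[of c "\<lambda>i. {..<k i}" x q "I - {x}"] assms by (simp add: insert_absorb)
qed

lemma restrict_upd_joint:
  assumes "q \<in> joint (I - {x}) k"
  shows "restrict (q(x := c)) (I - {x}) = q"
proof
  fix i
  show "restrict (q(x := c)) (I - {x}) i = q i"
    by (cases "i \<in> I - {x}") (auto simp: PiE_arb[OF assms])
qed

text \<open>The partial trace over the other factors of \<open>Y\<close> multiplied by the transpose
  of \<open>W\<close> on those factors. Below, \<open>W\<close> is itself the transpose of a
  pulled-back POVM element, so this is the unnormalized state of factor \<open>x\<close> after that
  outcome.\<close>

definition contract_others ::
  "'i set \<Rightarrow> ('i \<Rightarrow> nat) \<Rightarrow> 'i \<Rightarrow> ('i \<Rightarrow> nat) op \<Rightarrow> ('i \<Rightarrow> nat) op \<Rightarrow> nat op" where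
  "contract_others I h x W Y = (\<lambda>a b. if a < h x \<and> b < h x
     then \<Sum>s\<in>joint (I - {x}) h. \<Sum>t\<in>joint (I - {x}) h. W s t * Y (s(x := a)) (t(x := b))
     else 0)"

text \<open>Each Gram vector \<open>w l\<close> yields one Kraus operator: the row vector
  \<open>w l\<close> on the other factors, tensored with the identity on factor
  \<open>x\<close>.\<close>

lemma contract_others_cp:
  assumes I: "finite I" "x \<in> I"
    and W: "\<And>s t. s \<in> joint (I - {x}) h \<Longrightarrow> t \<in> joint (I - {x}) h \<Longrightarrow>
      W s t = (\<Sum>l\<in>L. w l s * cnj (w l t))"
  shows "cp_map (joint I h) {..<h x} (contract_others I h x W)"
proof -
  let ?S = "joint (I - {x}) h"
  define K where "K = (\<lambda>l a u. if a < h x \<and> u x = a then w l (restrict u (I - {x})) else 0)"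
  \<comment> \<open>Only indices u with \<open>u x = a\<close> contribute. The general f with
    \<open>f 0 u = 0\<close> lets one fact collapse both the row sum and the conjugated column
    sum.\<close>
  have row: "(\<Sum>u\<in>joint I h. f (K l a u) u) = (\<Sum>s\<in>?S. f (w l s) (s(x := a)))"
    if "a < h x" and f: "\<And>u. f 0 u = 0" for f :: "complex \<Rightarrow> _ \<Rightarrow> complex" and l a
  proof -
    have "(\<Sum>u\<in>joint I h. f (K l a u) u)
        = (\<Sum>c<h x. if c = a then \<Sum>s\<in>?S. f (w l s) (s(x := a)) else 0)"
      unfolding sum_joint_split[OF I(2)]
    proof (rule sum.cong[OF refl])
      fix c
      have "K l a (s(x := c)) = (if c = a then w l s else 0)" if "s \<in> ?S" for s
        using \<open>a < h x\<close> restrict_upd_joint[OF that] by (simp add: K_def)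
      then show "(\<Sum>s\<in>?S. f (K l a (s(x := c))) (s(x := c)))
          = (if c = a then \<Sum>s\<in>?S. f (w l s) (s(x := a)) else 0)"
        using f by simp
    qed
    then show ?thesis using that by simp
  qed
  show ?thesis
  proof (rule kraus_map_cp[where S = L and K = K])
    fix Y assume "Y \<in> ops (joint I h)"
    show "contract_others I h x W Y = kraus_map (joint I h) L K Y"
    proof (intro ext)
      fix a b
      show "contract_others I h x W Y a b = kraus_map (joint I h) L K Y a b"
      proof (cases "a < h x \<and> b < h x")
        case True
        have "kraus_map (joint I h) L K Y a b
            = (\<Sum>l\<in>L. \<Sum>u\<in>joint I h. K l a u * (\<Sum>v\<in>joint I h. Y u v * cnj (K l b v)))"
          by (simp add: kraus_map_def sum_distrib_left mult.assoc)
        also have "\<dots> = (\<Sum>l\<in>L. \<Sum>s\<in>?S. w l s * (\<Sum>t\<in>?S. Y (s(x := a)) (t(x := b)) * cnj (w l t)))"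
          using True row[of a "\<lambda>c u. c * (\<Sum>v\<in>joint I h. Y u v * cnj (K l b v))" l for l]
            row[of b "\<lambda>c v. Y u v * cnj c" l for l u]
          by simp
        also have "\<dots> = (\<Sum>l\<in>L. \<Sum>z\<in>?S \<times> ?S. w l (fst z) * cnj (w l (snd z)) *
            Y ((fst z)(x := a)) ((snd z)(x := b)))"
          by (simp add: sum.cartesian_product' sum_distrib_left mult_ac)
        also have "\<dots> = (\<Sum>z\<in>?S \<times> ?S. \<Sum>l\<in>L. w l (fst z) * cnj (w l (snd z)) *
            Y ((fst z)(x := a)) ((snd z)(x := b)))"
          by (rule sum.swap)
        also have "\<dots> = contract_others I h x W Y a b"
          using True W by (simp add: sum.cartesian_product' contract_others_def sum_distrib_right)
        finally show ?thesis by simp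
      next
        case False
        then have "\<not> a < h x \<or> \<not> b < h x" by blast
        then show ?thesis
          by (elim disjE) (simp_all add: contract_others_def kraus_map_def K_def)
      qed
    qed
  qed (use I in \<open>auto simp: K_def finite_joint split: if_splits\<close>)
qed

text \<open>The matrix on the left is the transpose of the image of \<open>M\<close> under the dual map of \<open>\<Phi>\<close>.\<close>

lemma cp_map_dual_psd:
  assumes "cp_map A B \<Phi>" "psd B M" "finite A" "finite B"
  obtains L :: "(nat \<times> nat) set" and w where
    "\<And>s t. s \<in> A \<Longrightarrow> t \<in> A \<Longrightarrow>
      (\<Sum>p\<in>B. \<Sum>q\<in>B. M p q * \<Phi> (unit_op s t) q p) = (\<Sum>l\<in>L. w l s * cnj (w l t))"
proof -
  obtain N :: nat and v where v: "\<And>p q. M p q = (\<Sum>m<N. v m p * cnj (v m q))"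
    using psd_decomposition[OF assms(4,2)] by metis
  obtain R :: nat and K where K: "\<And>X. X \<in> ops A \<Longrightarrow> \<Phi> X = kraus_map A {..<R} K X"
    using cp_map_kraus[OF assms(1,3,4)] by metis
  \<comment> \<open>Up to conjugation this is the adjoint of a Kraus operator applied to a Gram
    vector of \<open>M\<close>; the conjugate appears because the matrix in question is the
    transpose of the dual image.\<close>
  define w where "w = (\<lambda>l s. \<Sum>q\<in>B. cnj (v (fst l) q) * K (snd l) q s)"
  have "(\<Sum>p\<in>B. \<Sum>q\<in>B. M p q * \<Phi> (unit_op s t) q p)
      = (\<Sum>l\<in>{..<N} \<times> {..<R}. w l s * cnj (w l t))" if st: "s \<in> A" "t \<in> A" for s t
  proof -
    let ?f = "\<lambda>p q l. (v (fst l) p * cnj (v (fst l) q)) * (K (snd l) q s * cnj (K (snd l) p t))"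
    have "(\<Sum>p\<in>B. \<Sum>q\<in>B. M p q * \<Phi> (unit_op s t) q p)
        = (\<Sum>p\<in>B. \<Sum>q\<in>B. \<Sum>l\<in>{..<N} \<times> {..<R}. ?f p q l)"
      by (simp add: v K[OF unit_op_in_ops[OF st]] kraus_map_unit_op[OF assms(3) st] sum_product
          sum.cartesian_product')
    also have "\<dots> = (\<Sum>p\<in>B. \<Sum>l\<in>{..<N} \<times> {..<R}. \<Sum>q\<in>B. ?f p q l)"
      by (intro sum.cong refl sum.swap)
    also have "\<dots> = (\<Sum>l\<in>{..<N} \<times> {..<R}. \<Sum>p\<in>B. \<Sum>q\<in>B. ?f p q l)"
      by (rule sum.swap)
    also have "\<dots> = (\<Sum>l\<in>{..<N} \<times> {..<R}. (\<Sum>p\<in>B. v (fst l) p * cnj (K (snd l) p t)) *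
        (\<Sum>q\<in>B. cnj (v (fst l) q) * K (snd l) q s))"
      by (simp add: sum_product mult_ac)
    also have "\<dots> = (\<Sum>l\<in>{..<N} \<times> {..<R}. w l s * cnj (w l t))"
      by (simp add: w_def mult.commute)
    finally show ?thesis .
  qed
  then show ?thesis using that by blast
qed

text \<open>The reordering behind \<open>measured_output_eq\<close>: z runs over pairs of outputs of
  the other channels, w over pairs of their inputs, c over pairs of inputs of channel x. On the
  right the innermost sum forms the pulled-back POVM element, the middle one contracts it with the
  encoded state, and the outer one expands the action of channel x in matrix units.\<close>

lemma triple_sum_swap:
  fixes m :: "'p \<Rightarrow> 'z :: comm_semiring_0"
  shows "(\<Sum>z\<in>P. m z * (\<Sum>w\<in>S. \<Sum>c\<in>Q. y w c * g c * f w z))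
    = (\<Sum>c\<in>Q. (\<Sum>w\<in>S. (\<Sum>z\<in>P. m z * f w z) * y w c) * g c)"
proof -
  let ?t = "\<lambda>z w c. m z * (y w c * g c * f w z)"
  have "(\<Sum>z\<in>P. m z * (\<Sum>w\<in>S. \<Sum>c\<in>Q. y w c * g c * f w z)) = (\<Sum>z\<in>P. \<Sum>w\<in>S. \<Sum>c\<in>Q. ?t z w c)"
    by (simp add: sum_distrib_left)
  also have "\<dots> = (\<Sum>w\<in>S. \<Sum>z\<in>P. \<Sum>c\<in>Q. ?t z w c)"
    by (rule sum.swap)
  also have "\<dots> = (\<Sum>w\<in>S. \<Sum>c\<in>Q. \<Sum>z\<in>P. ?t z w c)"
    by (intro sum.cong refl sum.swap)
  also have "\<dots> = (\<Sum>c\<in>Q. \<Sum>w\<in>S. \<Sum>z\<in>P. ?t z w c)"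
    by (rule sum.swap)
  also have "\<dots> = (\<Sum>c\<in>Q. (\<Sum>w\<in>S. (\<Sum>z\<in>P. m z * f w z) * y w c) * g c)"
    by (simp add: sum_distrib_left sum_distrib_right mult_ac)
  finally show ?thesis .
qed

text \<open>
  Measuring the outputs of the other receivers commutes with \<open>C x\<close>: it amounts to a
  measurement of the other channel inputs, carried out before \<open>C x\<close> is applied.
\<close>

lemma measured_output_eq:
  assumes I: "finite I" "x \<in> I" and lin: "linear_map {..<h x} {..<k x} (C x)"
    and W: "W = (\<lambda>s t. \<Sum>p\<in>joint (I - {x}) k. \<Sum>q\<in>joint (I - {x}) k.
      M p q * tensor_map (I - {x}) h k C (unit_op s t) q p)"
  shows "trace_others I k x (op_mult (joint I k) (id_tensor I k x M) (tensor_map I h k C Y))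
    = C x (contract_others I h x W Y)"
proof (intro ext)
  fix a b
  let ?P = "joint (I - {x}) k" and ?S = "joint (I - {x}) h"
  let ?T = "tensor_map I h k C Y"
  let ?lhs = "trace_others I k x (op_mult (joint I k) (id_tensor I k x M) ?T)"
  have ops: "contract_others I h x W Y \<in> ops {..<h x}"
    by (rule opsI) (auto simp: contract_others_def)
  then have opsC: "C x (contract_others I h x W Y) \<in> ops {..<k x}"
    using lin by (simp add: linear_map_def)
  have fin: "finite (I - {x})" using I by simp
  show "?lhs a b = C x (contract_others I h x W Y) a b"
  proof (cases "a < k x \<and> b < k x")
    case True
    then have a: "a < k x" and b: "b < k x" by auto
    \<comment> \<open>The output pair is read in reverse, as in the trace of a product:
      \<open>M p q\<close> meets the entry at (q, p).\<close>
    let ?N = "\<lambda>w z. tensor_map (I - {x}) h k C (unit_op (fst w) (snd w)) (snd z) (fst z)"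
    have mult: "op_mult (joint I k) (id_tensor I k x M) ?T (p(x := a)) (p(x := b))
        = (\<Sum>q\<in>?P. M p q * ?T (q(x := a)) (p(x := b)))" if p: "p \<in> ?P" for p
    proof -
      have "op_mult (joint I k) (id_tensor I k x M) ?T (p(x := a)) (p(x := b))
          = (\<Sum>e<k x. \<Sum>q\<in>?P. id_tensor I k x M (p(x := a)) (q(x := e)) * ?T (q(x := e)) (p(x := b)))"
        unfolding op_mult_def by (rule sum_joint_split[OF I(2)])
      also have "\<dots> = (\<Sum>e<k x. if e = a then \<Sum>q\<in>?P. M p q * ?T (q(x := a)) (p(x := b)) else 0)"
      proof (rule sum.cong[OF refl])
        fix e assume "e \<in> {..<k x}"
        then have "id_tensor I k x M (p(x := a)) (q(x := e)) = (if e = a then M p q else 0)"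
          if "q \<in> ?P" for q
          using upd_in_joint_iff[OF I(2)] restrict_upd_joint p that a by (auto simp: id_tensor_def)
        then show "(\<Sum>q\<in>?P. id_tensor I k x M (p(x := a)) (q(x := e)) * ?T (q(x := e)) (p(x := b)))
            = (if e = a then \<Sum>q\<in>?P. M p q * ?T (q(x := a)) (p(x := b)) else 0)"
          by simp
      qed
      finally show ?thesis using a by simp
    qed
    \<comment> \<open>The product over all receivers splits into the factor of \<open>x\<close>,
      which sees only the inputs c and the outputs a, b, and the tensor product of the
      others.\<close>
    have T: "?T (q(x := a)) (p(x := b)) = (\<Sum>w\<in>?S \<times> ?S. \<Sum>c\<in>{..<h x} \<times> {..<h x}.
        Y ((fst w)(x := fst c)) ((snd w)(x := snd c)) * C x (unit_op (fst c) (snd c)) a b * ?N w (p, q))"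
      if p: "p \<in> ?P" and q: "q \<in> ?P" for p q
    proof -
      let ?g = "\<lambda>s t. \<Prod>i\<in>I. C i (unit_op (s i) (t i)) ((q(x := a)) i) ((p(x := b)) i)"
      have g: "?g (s(x := c)) (t(x := c')) = C x (unit_op c c') a b * ?N (s, t) (p, q)"
        if "s \<in> ?S" "t \<in> ?S" for s t c c'
      proof -
        have "?g (s(x := c)) (t(x := c')) = C x (unit_op c c') a b *
            (\<Prod>i\<in>I - {x}. C i (unit_op (s i) (t i)) (q i) (p i))"
          by (subst prod.remove[OF I]) simp
        then show ?thesis
          using tensor_map_unit_op[OF fin that q p] by simp
      qed
      have "?T (q(x := a)) (p(x := b)) = (\<Sum>s\<in>joint I h. \<Sum>t\<in>joint I h. Y s t * ?g s t)"
        using upd_in_joint_iff[OF I(2)] p q a b unfolding tensor_map_def by simp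
      also have "\<dots> = (\<Sum>c<h x. \<Sum>s\<in>?S. \<Sum>c'<h x. \<Sum>t\<in>?S.
          Y (s(x := c)) (t(x := c')) * ?g (s(x := c)) (t(x := c')))"
        unfolding sum_joint_split[OF I(2)] ..
      also have "\<dots> = (\<Sum>c<h x. \<Sum>s\<in>?S. \<Sum>c'<h x. \<Sum>t\<in>?S.
          Y (s(x := c)) (t(x := c')) * C x (unit_op c c') a b * ?N (s, t) (p, q))"
        by (intro sum.cong refl) (simp only: g mult.assoc)
      also have "\<dots> = (\<Sum>s\<in>?S. \<Sum>c<h x. \<Sum>c'<h x. \<Sum>t\<in>?S.
          Y (s(x := c)) (t(x := c')) * C x (unit_op c c') a b * ?N (s, t) (p, q))"
        by (rule sum.swap)
      also have "\<dots> = (\<Sum>s\<in>?S. \<Sum>c\<in>{..<h x} \<times> {..<h x}. \<Sum>t\<in>?S.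
          Y (s(x := fst c)) (t(x := snd c)) * C x (unit_op (fst c) (snd c)) a b * ?N (s, t) (p, q))"
        by (simp add: sum.cartesian_product')
      also have "\<dots> = (\<Sum>s\<in>?S. \<Sum>t\<in>?S. \<Sum>c\<in>{..<h x} \<times> {..<h x}.
          Y (s(x := fst c)) (t(x := snd c)) * C x (unit_op (fst c) (snd c)) a b * ?N (s, t) (p, q))"
        by (intro sum.cong refl sum.swap)
      finally show ?thesis by (simp add: sum.cartesian_product'[of _ ?S ?S])
    qed
    have "?lhs a b = (\<Sum>p\<in>?P. \<Sum>q\<in>?P. M p q * ?T (q(x := a)) (p(x := b)))"
      unfolding trace_others_def by (simp only: mult cong: sum.cong)
    also have "\<dots> = (\<Sum>z\<in>?P \<times> ?P. M (fst z) (snd z) * (\<Sum>w\<in>?S \<times> ?S. \<Sum>c\<in>{..<h x} \<times> {..<h x}.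
        Y ((fst w)(x := fst c)) ((snd w)(x := snd c)) * C x (unit_op (fst c) (snd c)) a b * ?N w z))"
      unfolding sum.cartesian_product'[of _ ?P ?P] fst_conv snd_conv
      by (intro sum.cong refl) (simp only: T fst_conv snd_conv)
    also have "\<dots> = (\<Sum>c\<in>{..<h x} \<times> {..<h x}. (\<Sum>w\<in>?S \<times> ?S. (\<Sum>z\<in>?P \<times> ?P. M (fst z) (snd z) * ?N w z) *
        Y ((fst w)(x := fst c)) ((snd w)(x := snd c))) * C x (unit_op (fst c) (snd c)) a b)"
      by (rule triple_sum_swap)
    also have "\<dots> = (\<Sum>c<h x. \<Sum>c'<h x. contract_others I h x W Y c c' * C x (unit_op c c') a b)"
      by (simp add: sum.cartesian_product' contract_others_def W)
    also have "\<dots> = C x (contract_others I h x W Y) a b"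
      by (rule linear_map_expand[OF lin finite_lessThan ops, symmetric])
    finally show ?thesis .
  next
    case False
    have "op_mult (joint I k) (id_tensor I k x M) ?T (p(x := a)) (p(x := b)) = 0" if "p \<in> ?P" for p
    proof -
      from False consider "\<not> a < k x" | "\<not> b < k x" by blast
      then show ?thesis
      proof cases
        case 1
        then show ?thesis
          using upd_in_joint_iff[OF I(2) that] by (simp add: op_mult_def id_tensor_def)
      next
        case 2
        then show ?thesis
          using upd_in_joint_iff[OF I(2) that] by (simp add: op_mult_def tensor_map_def)
      qed
    qed
    then have "?lhs a b = 0" by (simp add: trace_others_def)
    then show ?thesis using opsD[OF opsC, of a b] False by auto
  qed
qed

section \<open>Extracting a perfect one-shot code from a single outcome\<close>

lemma linear_map_scale:
  assumes "linear_map A B \<Phi>" "X \<in> ops A"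
  shows "\<Phi> (\<lambda>a b. c * X a b) = (\<lambda>a b. c * \<Phi> X a b)"
  using linear_map_sum[OF assms(1), of "{()}" "\<lambda>_. X" "\<lambda>_. c"] assms(2) by simp

lemma psd_scale:
  assumes "psd A X" "0 \<le> c"
  shows "psd A (\<lambda>a b. of_real c * X a b)"
proof -
  have "expval A v (\<lambda>a b. of_real c * X a b) = of_real c * expval A v X" for v
    by (simp add: expval_def sum_distrib_left mult_ac)
  then show ?thesis
    using assms by (auto simp: psd_def ops_def)
qed

lemma cp_map_scale:
  assumes "cp_map A B \<Phi>" "0 \<le> c"
  shows "cp_map A B (\<lambda>X a b. of_real c * \<Phi> X a b)"
proof -
  have "linear_map A B (\<lambda>X a b. of_real c * \<Phi> X a b)"
    unfolding linear_map_def
  proof (intro conjI ballI allI)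
    show "(\<lambda>a b. of_real c * \<Phi> X a b) \<in> ops B" if "X \<in> ops A" for X
      using opsD[OF cp_map_ops[OF assms(1) that]] by (intro opsI) simp
    show "(\<lambda>u v. of_real c * \<Phi> (\<lambda>a b. e * X a b + Y a b) u v)
        = (\<lambda>u v. e * (of_real c * \<Phi> X u v) + of_real c * \<Phi> Y u v)"
      if "X \<in> ops A" "Y \<in> ops A" for X Y e
      unfolding linear_mapD[OF cp_map_linear[OF assms(1)] that] by (simp add: algebra_simps)
  qed
  moreover have "psd ({..<r} \<times> B) (amplify (\<lambda>X a b. of_real c * \<Phi> X a b) X)"
    if "psd ({..<r} \<times> A) X" for r :: nat and X
  proof -
    have "amplify (\<lambda>X a b. of_real c * \<Phi> X a b) X = (\<lambda>z y. of_real c * amplify \<Phi> X z y)"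
      by (intro ext) (auto simp: amplify_def)
    moreover have "psd ({..<r} \<times> B) (amplify \<Phi> X)"
      using assms(1) that by (simp add: cp_map_def)
    ultimately show ?thesis using psd_scale[OF _ assms(2)] by (simp only:)
  qed
  ultimately show ?thesis by (simp add: cp_map_def)
qed

lemma density_unit_op:
  assumes "finite A" "a \<in> A"
  shows "density A (unit_op a a)"
proof -
  have "unit_op a a = (\<lambda>u v. (if u = a then 1 else 0) * cnj (if v = a then 1 else 0))"
    by (auto simp: unit_op_def fun_eq_iff)
  moreover have "psd A (\<lambda>u v. (if u = a then 1 else 0) * cnj (if v = a then 1 else 0))"
    by (rule psd_rank_one) (use assms(2) in \<open>auto split: if_splits\<close>)
  ultimately have "psd A (unit_op a a)" by (simp only:)
  then show ?thesis
    using assms by (simp add: density_def op_trace_unit_op)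
qed

lemma one_way_protocol_perfect_code:
  assumes d: "d \<ge> 1" and ch: "\<And>i. i \<in> {1..n} \<Longrightarrow> channel {..<h i} {..<k i} (C i)"
    and prot: "one_way_protocol d n h k C E J M B" and x: "x \<in> {1..n}"
  obtains F G where "channel {..<d} {..<h x} F" "channel {..<k x} {..<d} G"
    "\<And>X. X \<in> ops {..<d} \<Longrightarrow> G (C x (F X)) = X"
proof -
  let ?I = "{1..n}"
  note cpC = ch[unfolded channel_def, THEN conjunct1]
  have E: "cp_map {..<d} (joint ?I h) E"
    using prot by (simp add: one_way_protocol_def channel_def)
  have J: "finite (J x)" and M: "\<And>j. j \<in> J x \<Longrightarrow> psd (joint (?I - {x}) k) (M x j)"
    using prot x by (auto simp: one_way_protocol_def locc_povm_def povm_def)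
  have B: "channel {..<k x} {..<d} (B x j)" if "j \<in> J x" for j
    using prot x that by (auto simp: one_way_protocol_def)
  have decode: "(\<lambda>a b. \<Sum>j\<in>J x. B x j (trace_others ?I k x (op_mult (joint ?I k)
      (id_tensor ?I k x (M x j)) (tensor_map ?I h k C (E \<rho>)))) a b) = \<rho>" if "density {..<d} \<rho>" for \<rho>
    using prot x that by (auto simp: one_way_protocol_def)
  define W where "W = (\<lambda>j s t. \<Sum>p\<in>joint (?I - {x}) k. \<Sum>q\<in>joint (?I - {x}) k.
      M x j p q * tensor_map (?I - {x}) h k C (unit_op s t) q p)"
  define F where "F = (\<lambda>j X. contract_others ?I h x (W j) (E X))"
  have F: "cp_map {..<d} {..<h x} (F j)" if j: "j \<in> J x" for j
  proof -
    have "cp_map (joint (?I - {x}) h) (joint (?I - {x}) k) (tensor_map (?I - {x}) h k C)"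
      by (rule tensor_map_cp) (use cpC in auto)
    then obtain L :: "(nat \<times> nat) set" and w where
      "\<And>s t. s \<in> joint (?I - {x}) h \<Longrightarrow> t \<in> joint (?I - {x}) h \<Longrightarrow>
        W j s t = (\<Sum>l\<in>L. w l s * cnj (w l t))"
      unfolding W_def by (rule cp_map_dual_psd[OF _ M[OF j]]) (auto simp: finite_joint)
    then have "cp_map (joint ?I h) {..<h x} (contract_others ?I h x (W j))"
      by (intro contract_others_cp) (use x in auto)
    then show ?thesis unfolding F_def by (rule cp_map_comp[OF E])
  qed
  define T where "T = (\<lambda>j X. B x j (C x (F j X)))"
  have T: "cp_map {..<d} {..<d} (T j)" if "j \<in> J x" for j
    unfolding T_def
    by (rule cp_map_comp[OF cp_map_comp[OF F[OF that] cpC[OF x]]])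
      (use B[OF that] in \<open>simp add: channel_def\<close>)
  have Tsum: "(\<lambda>a b. \<Sum>j\<in>J x. T j \<rho> a b) = \<rho>" if "density {..<d} \<rho>" for \<rho>
  proof -
    have "trace_others ?I k x (op_mult (joint ?I k) (id_tensor ?I k x (M x j)) (tensor_map ?I h k C (E \<rho>)))
        = C x (F j \<rho>)" for j
      unfolding F_def
      by (rule measured_output_eq[where C = C and h = h and k = k and x = x and M = "M x j"])
        (simp, rule x, rule cp_map_linear[OF cpC[OF x]], simp only: W_def)
    then show ?thesis using decode[OF that] by (simp add: T_def)
  qed
  have "\<exists>p::real. 0 \<le> p \<and> (\<forall>X\<in>ops {..<d}. T j X = (\<lambda>a b. of_real p * X a b))" if "j \<in> J x" for j
    by (rule cp_summand_of_id[of "{..<d}" "J x" T j, OF finite_lessThan J T Tsum that]) blast+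
  then have "\<exists>p::nat \<Rightarrow> real. \<forall>j\<in>J x. 0 \<le> p j \<and>
      (\<forall>X\<in>ops {..<d}. T j X = (\<lambda>a b. of_real (p j) * X a b))"
    by (intro bchoice) blast
  then obtain p :: "nat \<Rightarrow> real" where p0: "\<And>j. j \<in> J x \<Longrightarrow> 0 \<le> p j"
    and p: "\<And>j X. j \<in> J x \<Longrightarrow> X \<in> ops {..<d} \<Longrightarrow> T j X = (\<lambda>a b. of_real (p j) * X a b)"
    by blast
  \<comment> \<open>The entry at (0, 0) of the decoding identity for this state says that the
    \<open>p j\<close> sum to 1; \<open>d \<ge> 1\<close> supplies the basis vector 0.\<close>
  have "density {..<d} (unit_op 0 0)"
    using d by (intro density_unit_op) auto
  note eq = Tsum[OF this]
  have "(\<Sum>j\<in>J x. T j (unit_op 0 0) 0 0) = unit_op 0 0 (0::nat) 0"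
    by (rule fun_cong[OF fun_cong[OF eq]])
  moreover have "unit_op 0 0 \<in> ops {..<d}"
    using d by (intro unit_op_in_ops) auto
  ultimately have "(\<Sum>j\<in>J x. of_real (p j)) = (1 :: complex)"
    by (simp add: p unit_op_def cong: sum.cong)
  then obtain j where j: "j \<in> J x" and "p j \<noteq> 0"
    by (metis (no_types, lifting) of_real_0 sum.neutral zero_neq_one)
  then have pj: "p j > 0" using p0[OF j] by simp
  define F' where "F' = (\<lambda>X a b. of_real (1 / p j) * F j X a b)"
  \<comment> \<open>The decoder and \<open>C x\<close> preserve the trace, so the known factor
    \<open>p j\<close> of the whole composition is already the factor by which \<open>F j\<close>
    scales traces. Dividing by it makes \<open>F'\<close> trace preserving.\<close>
  have trace: "op_trace {..<d} (T j X) = op_trace {..<h x} (F j X)" if "X \<in> ops {..<d}" for X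
    using B[OF j] ch[OF x] cp_map_ops[OF F[OF j] that] cp_map_ops[OF cpC[OF x]]
    by (simp add: T_def channel_def)
  have "op_trace {..<h x} (F' X) = op_trace {..<d} X" if "X \<in> ops {..<d}" for X
  proof -
    have "op_trace {..<h x} (F' X) = of_real (1 / p j) * op_trace {..<h x} (F j X)"
      by (simp only: F'_def op_trace_def sum_distrib_left)
    also have "\<dots> = of_real (1 / p j) * (of_real (p j) * op_trace {..<d} X)"
      unfolding trace[OF that, symmetric] p[OF j that] by (simp only: op_trace_def sum_distrib_left)
    finally show ?thesis using pj by simp
  qed
  then have "channel {..<d} {..<h x} F'"
    using cp_map_scale[OF F[OF j], of "1 / p j"] pj by (simp add: channel_def F'_def)
  moreover have "B x j (C x (F' X)) = X" if X: "X \<in> ops {..<d}" for X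
  proof -
    have cpB: "cp_map {..<k x} {..<d} (B x j)" using B[OF j] by (simp add: channel_def)
    note FX = cp_map_ops[OF F[OF j] X]
    have "B x j (C x (F' X)) = (\<lambda>a b. of_real (1 / p j) * T j X a b)"
      unfolding F'_def T_def linear_map_scale[OF cp_map_linear[OF cpC[OF x]] FX]
      by (rule linear_map_scale[OF cp_map_linear[OF cpB] cp_map_ops[OF cpC[OF x] FX]])
    then show ?thesis using pj p[OF j X] by simp
  qed
  ultimately show ?thesis using that B[OF j] by blast
qed

subsection \<open>Codes from perfect one-shot transmission\<close>

text \<open>\<open>has_code\<close> fixes the message basis as an initial segment of the naturals,
  while a tensor power has choice functions as its basis. A bijection of bases acts as a channel
  with a permutation matrix as its only Kraus operator.\<close>

lemma relabel_channel:
  assumes e: "bij_betw e B A" and fin: "finite A" "finite B"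
  shows "channel A B (\<lambda>X p q. if p \<in> B \<and> q \<in> B then X (e p) (e q) else 0)" (is "channel A B ?R")
proof -
  define K where "K = (\<lambda>(i::unit) p a. if p \<in> B \<and> a = e p then 1 else (0::complex))"
  have "cp_map A B ?R"
  proof (rule kraus_map_cp[where S = "{()}" and K = K])
    fix X
    have "kraus_map A {()} K X p q = ?R X p q" for p q
    proof (cases "p \<in> B \<and> q \<in> B")
      case True
      then have "kraus_map A {()} K X p q
          = (\<Sum>a\<in>A. if a = e p then \<Sum>b\<in>A. if b = e q then X (e p) (e q) else 0 else 0)"
        unfolding kraus_map_def by (auto simp: K_def intro!: sum.cong)
      then show ?thesis
        using True fin bij_betw_apply[OF e] by simp
    next
      case False
      then show ?thesis by (auto simp: kraus_map_def K_def)
    qed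
    then show "?R X = kraus_map A {()} K X" by (intro ext) (rule sym)
  qed (use fin in \<open>auto simp: K_def split: if_splits\<close>)
  moreover have "op_trace B (?R X) = op_trace A X" for X
    using sum.reindex_bij_betw[OF e, of "\<lambda>a. X a a"] by (simp add: op_trace_def)
  ultimately show ?thesis by (simp add: channel_def)
qed

text \<open>Tensor powers of \<open>F\<close> and \<open>G\<close> invert the tensor power of
  \<open>C\<close> exactly. The amplified composition therefore fixes every state shared with a
  reference, and the fidelity is 1.\<close>

lemma perfect_code_power:
  assumes C: "channel {..<h} {..<k} C" and F: "channel {..<d} {..<h} F"
    and G: "channel {..<k} {..<d} G" and FG: "\<And>X. X \<in> ops {..<d} \<Longrightarrow> G (C (F X)) = X"
    and "0 \<le> \<epsilon>"
  shows "has_code h k C m (d ^ m) \<epsilon>"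
proof -
  let ?I = "{..<m}" and ?D = "{..<d ^ m}"
  let ?P = "joint ?I (\<lambda>_. d)"
  have fin: "finite ?P" by (rule finite_joint) simp
  have "card ?P = d ^ m" by (simp add: card_PiE)
  then obtain e where e: "bij_betw e ?D ?P"
    using ex_bij_betw_nat_finite[OF fin] by (auto simp: atLeast0LessThan)
  define e' where "e' = the_inv_into ?D e"
  have e': "bij_betw e' ?P ?D"
    unfolding e'_def by (rule bij_betw_the_inv_into[OF e])
  have e'e: "e' (e i) = i" if "i \<in> ?D" for i
    unfolding e'_def using e that by (auto simp: bij_betw_def the_inv_into_f_f)
  define R :: "nat op \<Rightarrow> (nat \<Rightarrow> nat) op"
    where "R = (\<lambda>X p q. if p \<in> ?P \<and> q \<in> ?P then X (e' p) (e' q) else 0)"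
  define R' :: "(nat \<Rightarrow> nat) op \<Rightarrow> nat op"
    where "R' = (\<lambda>X p q. if p \<in> ?D \<and> q \<in> ?D then X (e p) (e q) else 0)"
  have R: "channel ?D ?P R" unfolding R_def by (rule relabel_channel[OF e' _ fin]) simp
  have R': "channel ?P ?D R'" unfolding R'_def by (rule relabel_channel[OF e fin]) simp
  have RR: "R' (R X) = X" if "X \<in> ops ?D" for X
    using opsD[OF that] bij_betw_apply[OF e] by (intro ext) (auto simp: R_def R'_def e'e)
  define TF where "TF = tensor_map ?I (\<lambda>_. d) (\<lambda>_. h) (\<lambda>_. F)"
  define TG where "TG = tensor_map ?I (\<lambda>_. k) (\<lambda>_. d) (\<lambda>_. G)"
  define TC where "TC = tensor_map ?I (\<lambda>_. h) (\<lambda>_. k) (\<lambda>_. C)"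
  have TF: "channel ?P (joint ?I (\<lambda>_. h)) TF" unfolding TF_def by (rule tensor_map_channel) (use F in auto)
  have TG: "channel (joint ?I (\<lambda>_. k)) ?P TG" unfolding TG_def by (rule tensor_map_channel) (use G in auto)
  have lin: "linear_map {..<d} {..<h} F" "linear_map {..<h} {..<k} C" "linear_map {..<k} {..<d} G"
    using F C G by (simp_all add: channel_def cp_map_def)
  have linGC: "linear_map {..<h} {..<d} (\<lambda>Y. G (C Y))"
    using cp_map_linear[OF cp_map_comp[of "{..<h}" "{..<k}" C "{..<d}" G]] C G by (simp add: channel_def)
  have id: "TG (TC (TF X)) = X" if "X \<in> ops ?P" for X
  proof -
    have "TG (TC (TF X)) = tensor_map ?I (\<lambda>_. h) (\<lambda>_. d) (\<lambda>i Y. G (C Y)) (TF X)"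
      unfolding TG_def TC_def by (rule tensor_map_comp) (use lin in auto)
    also have "\<dots> = tensor_map ?I (\<lambda>_. d) (\<lambda>_. d) (\<lambda>i Y. G (C (F Y))) X"
      unfolding TF_def by (rule tensor_map_comp) (use lin linGC in auto)
    also have "\<dots> = X"
      by (rule tensor_map_id) (use that FG in auto)
    finally show ?thesis .
  qed
  define Enc where "Enc = (\<lambda>X. TF (R X))"
  define Dec where "Dec = (\<lambda>X. R' (TG X))"
  have Enc: "channel ?D (joint ?I (\<lambda>_. h)) Enc" unfolding Enc_def by (rule channel_comp[OF R TF])
  have Dec: "channel (joint ?I (\<lambda>_. k)) ?D Dec" unfolding Dec_def by (rule channel_comp[OF TG R'])
  have code: "Dec (TC (Enc X)) = X" if X: "X \<in> ops ?D" for X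
  proof -
    have "R X \<in> ops ?P"
      by (rule cp_map_ops[OF conjunct1[OF R[unfolded channel_def]] X])
    then show ?thesis
      unfolding Dec_def Enc_def by (simp only: id RR[OF X])
  qed
  have fid: "1 - \<epsilon> \<le> Re (expval ({..<r} \<times> ?D) \<phi> (amplify (\<lambda>X. Dec (TC (Enc X)))
      (\<lambda>z w. if z \<in> {..<r} \<times> ?D \<and> w \<in> {..<r} \<times> ?D then \<phi> z * cnj (\<phi> w) else 0)))"
    if \<phi>: "(\<Sum>z\<in>{..<r} \<times> ?D. (cmod (\<phi> z))\<^sup>2) = 1" for r :: nat and \<phi>
  proof -
    let ?Z = "{..<r} \<times> ?D"
    let ?\<phi> = "\<lambda>z w. if z \<in> ?Z \<and> w \<in> ?Z then \<phi> z * cnj (\<phi> w) else 0"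
    have "amplify (\<lambda>X. Dec (TC (Enc X))) ?\<phi> z w = ?\<phi> z w" for z w
    proof -
      obtain s a t b where zw: "z = (s, a)" "w = (t, b)" by (cases z, cases w)
      \<comment> \<open>Exact decoding is known only for operators supported on the message space.
        Each reference block of the state qualifies, since the state is cut to zero outside.\<close>
      have "(\<lambda>a b. ?\<phi> (s, a) (t, b)) \<in> ops ?D" by (rule opsI) auto
      from code[OF this] show ?thesis by (simp add: amplify_def zw)
    qed
    then have "expval ?Z \<phi> (amplify (\<lambda>X. Dec (TC (Enc X))) ?\<phi>) = expval ?Z \<phi> ?\<phi>"
      unfolding expval_def by (simp only:)
    also have "\<dots> = expval ?Z \<phi> (\<lambda>z w. \<phi> z * cnj (\<phi> w))"
      by (simp add: expval_def cong: sum.cong)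
    also have "\<dots> = 1"
    proof -
      have "(\<Sum>z\<in>?Z. cnj (\<phi> z) * \<phi> z) = of_real (\<Sum>z\<in>?Z. (cmod (\<phi> z))\<^sup>2)"
        unfolding of_real_sum by (intro sum.cong refl) (simp only: complex_norm_square mult.commute)
      then have "(\<Sum>z\<in>?Z. cnj (\<phi> z) * \<phi> z) = 1" unfolding \<phi> by simp
      then show ?thesis unfolding expval_rank_one by simp
    qed
    finally show ?thesis using \<open>0 \<le> \<epsilon>\<close> by simp
  qed
  show ?thesis
    unfolding has_code_def TC_def[symmetric] using Enc Dec fid by blast
qed

theorem theorem1:
  fixes d n :: nat
    and h k :: "nat \<Rightarrow> nat"
    and C :: "nat \<Rightarrow> nat op \<Rightarrow> nat op"
  assumes "d \<ge> 1" and "n \<ge> 2"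
    and "\<forall>i\<in>{1..n}. channel {..<h i} {..<k i} (C i)"
    and "\<exists>E J M B. one_way_protocol d n h k C E J M B"
  shows "\<forall>i\<in>{1..n}. quantum_capacity (h i) (k i) (C i) \<ge> ereal (log 2 (real d))"
proof
  fix x assume x: "x \<in> {1..n}"
  obtain E J M B where "one_way_protocol d n h k C E J M B"
    using assms(4) by blast
  then obtain F G where FG: "channel {..<d} {..<h x} F" "channel {..<k x} {..<d} G"
    "\<And>X. X \<in> ops {..<d} \<Longrightarrow> G (C x (F X)) = X"
    using one_way_protocol_perfect_code[OF assms(1) _ _ x] assms(3) by metis
  have "achievable_rate (h x) (k x) (C x) (log 2 (real d))"
    unfolding achievable_rate_def
  proof (intro allI impI)
    fix \<epsilon> \<delta> :: real
    assume "0 < \<epsilon>" "0 < \<delta>"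
    \<comment> \<open>With D = d^m the rate is exactly \<open>log 2 d\<close> for each positive m.
      At m = 0 division by zero would give rate 0, and the eventual quantifier permits leaving this
      case out.\<close>
    have "\<exists>D\<ge>1. log 2 (real d) - \<delta> \<le> log 2 (real D) / real m \<and> has_code (h x) (k x) (C x) m D \<epsilon>"
      if "m \<ge> 1" for m
    proof (intro exI[of _ "d ^ m"] conjI)
      show "1 \<le> d ^ m" using assms(1) by simp
      show "log 2 (real d) - \<delta> \<le> log 2 (real (d ^ m)) / real m"
        using assms(1) that \<open>0 < \<delta>\<close> by (simp add: log_nat_power)
      show "has_code (h x) (k x) (C x) m (d ^ m) \<epsilon>"
        by (rule perfect_code_power[OF _ FG]) (use assms(3) x \<open>0 < \<epsilon>\<close> in auto)
    qed
    then show "\<forall>\<^sub>F m in sequentially. \<exists>D\<ge>1. log 2 (real d) - \<delta> \<le> log 2 (real D) / real m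
        \<and> has_code (h x) (k x) (C x) m D \<epsilon>"
      by (rule eventually_sequentiallyI)
  qed
  \<comment> \<open>The supremum defining the capacity ranges over nonnegative rates.\<close>
  moreover have "0 \<le> log 2 (real d)" using assms(1) by simp
  ultimately show "ereal (log 2 (real d)) \<le> quantum_capacity (h x) (k x) (C x)"
    unfolding quantum_capacity_def by (intro SUP_upper) simp
qed

end
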